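(* Let $\Sigma$ be a finite set of tgds and egds over a schema $\mathbf R$, let $I$ be an instance, and let $\star\in\{\mathsf{std},\mathsf{obl},\mathsf{sobl},\mathsf{core}\}$. Let $\Sigma^{tgd}$ be the set of tgds obtained as follows, using a new binary relation symbol $E\notin\mathbf R$: (1) every tgd of $\Sigma$ is in $\Sigma^{tgd}$; (2) for each egd $\alpha\rightarrow x=y$ in $\Sigma$, the tgd $\alpha\rightarrow E(x,y),E(y,x)$ is in $\Sigma^{tgd}$; (3) for each relation symbol $R$ used in $\Sigma$ and each $1\le i\le\mathrm{arity}(R)$, the tgd $E(x,y),R(x_1,\dots,x_{i-1},x,x_{i+1},\dots,x_{\mathrm{arity}(R)})\rightarrow R(x_1,\dots,x_{i-1},y,x_{i+1},\dots,x_{\mathrm{arity}(R)})$ is in $\Sigma^{tgd}$. If the $\star$-chase on $I$ with $\Sigma^{tgd}$ terminates, then so does the $\star$-chase on $I$ with $\Sigma$.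
   Context: Instances are finite sets of atoms over constants ($\mathsf{Cons}$) and nulls ($\mathsf{Nulls}$). A tgd is $\forall\bar x\forall\bar y\,(\alpha(\bar x,\bar y)\rightarrow\exists\bar z\,\beta(\bar x,\bar z))$; an egd is $\forall\bar x\,(\alpha(\bar x)\rightarrow x=y)$ with $x,y$ in $\bar x$; $\alpha,\beta$ are conjunctions of atoms. A trigger is $(\xi,h)$ with $h$ a mapping on body variables (identity on constants) and $h(\alpha)\subseteq I$. For a tgd it is active if no extension $h'$ has $h'(\beta)\subseteq I$; firing it adds $h'(\beta)$ where $h'$ extends $h$ with fresh nulls for existential variables. For an egd it is active if $h(x)\ne h(y)$; firing it replaces, if both are nulls, all occurrences of the later null by the earlier one (in a fixed enumeration); if one is a null and the other a constant, all occurrences of the null by the constant; if both are constants, the chase fails. Chase variants: standard chase fires (nondeterministically) active triggers; oblivious chase fires any trigger but each trigger at most once; semi-oblivious chase fires any trigger but for each tgd at most one trigger among those whose mappings agree on the variables $\bar x$ shared by body and head; core chase applies active egd triggers, otherwise fires all active tgd triggers in parallel and replaces the union of the results by its core. A chase terminates when it reaches an instance where the respective variant admits no further step. *)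

theory Defs
  imports Main
begin

text \<open>Terms of instances: constants or labelled nulls; nulls are enumerated by nat
  (the fixed enumeration used by egd steps).\<close>
datatype 'c trm = Cst 'c | Nul nat

datatype 'c rtrm = RCst 'c | RVar nat

type_synonym ('r,'c) atom = "'r \<times> 'c trm list"
type_synonym ('r,'c) ratom = "'r \<times> 'c rtrm list"

text \<open>TGD body head  stands for  body \<rightarrow> \<exists>z. head;  EGD body x y  stands for body \<rightarrow> x = y.\<close>
datatype ('r,'c) dep =
    TGD "('r,'c) ratom list" "('r,'c) ratom list"
  | EGD "('r,'c) ratom list" nat nat

fun is_tgd :: "('r,'c) dep \<Rightarrow> bool" where
  "is_tgd (TGD _ _) = True" | "is_tgd (EGD _ _ _) = False"

fun body :: "('r,'c) dep \<Rightarrow> ('r,'c) ratom list" where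
  "body (TGD b _) = b" | "body (EGD b _ _) = b"

fun heads :: "('r,'c) dep \<Rightarrow> ('r,'c) ratom list" where
  "heads (TGD _ h) = h" | "heads (EGD _ _ _) = []"

fun rvars :: "'c rtrm \<Rightarrow> nat set" where
  "rvars (RVar v) = {v}" | "rvars (RCst _) = {}"

definition avars :: "('r,'c) ratom list \<Rightarrow> nat set" where
  "avars as = (\<Union>a\<in>set as. \<Union>t\<in>set (snd a). rvars t)"

definition bvars :: "('r,'c) dep \<Rightarrow> nat set" where
  "bvars \<xi> = avars (body \<xi>)"

definition evars :: "('r,'c) dep \<Rightarrow> nat set" where
  "evars \<xi> = avars (heads \<xi>) - avars (body \<xi>)"

text \<open>variables on which the semi-oblivious chase identifies triggers: the frontier
  (variables shared by body and head) for tgds; all body variables for egds.\<close>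
fun key_vars :: "('r,'c) dep \<Rightarrow> nat set" where
  "key_vars (TGD b h) = avars b \<inter> avars h"
| "key_vars (EGD b x y) = avars b"

fun inst_t :: "(nat \<Rightarrow> 'c trm) \<Rightarrow> 'c rtrm \<Rightarrow> 'c trm" where
  "inst_t h (RVar v) = h v" | "inst_t h (RCst c) = Cst c"

definition inst :: "(nat \<Rightarrow> 'c trm) \<Rightarrow> ('r,'c) ratom list \<Rightarrow> ('r,'c) atom set" where
  "inst h as = (\<lambda>(r,ts). (r, map (inst_t h) ts)) ` set as"

definition nulls_of :: "('r,'c) atom set \<Rightarrow> nat set" where
  "nulls_of I = {n. \<exists>a\<in>I. Nul n \<in> set (snd a)}"

definition rels_of :: "('r,'c) dep set \<Rightarrow> 'r set" where
  "rels_of \<Sigma> = {R. \<exists>\<xi>\<in>\<Sigma>. \<exists>ts. (R,ts) \<in> set (body \<xi>) \<union> set (heads \<xi>)}"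

definition is_trigger :: "('r,'c) atom set \<Rightarrow> ('r,'c) dep \<Rightarrow> (nat \<Rightarrow> 'c trm) \<Rightarrow> bool" where
  "is_trigger I \<xi> h \<longleftrightarrow> inst h (body \<xi>) \<subseteq> I"

fun active :: "('r,'c) atom set \<Rightarrow> ('r,'c) dep \<Rightarrow> (nat \<Rightarrow> 'c trm) \<Rightarrow> bool" where
  "active I (TGD b hs) h \<longleftrightarrow>
     \<not> (\<exists>h'. (\<forall>v\<in>avars b. h' v = h v) \<and> inst h' hs \<subseteq> I)"
| "active I (EGD b x y) h \<longleftrightarrow> h x \<noteq> h y"

definition fresh_ext :: "('r,'c) atom set \<Rightarrow> ('r,'c) dep \<Rightarrow> (nat \<Rightarrow> 'c trm) \<Rightarrow> (nat \<Rightarrow> 'c trm) \<Rightarrow> bool" where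
  "fresh_ext I \<xi> h h' \<longleftrightarrow> (\<forall>v\<in>bvars \<xi>. h' v = h v) \<and> inj_on h' (evars \<xi>)
      \<and> (\<forall>v\<in>evars \<xi>. \<exists>n. h' v = Nul n \<and> n \<notin> nulls_of I)"

definition restr :: "(nat \<Rightarrow> 'c trm) \<Rightarrow> nat set \<Rightarrow> nat \<Rightarrow> 'c trm option" where
  "restr h V = (\<lambda>v. if v \<in> V then Some (h v) else None)"

datatype ('r,'c) st = Fail | Inst "('r,'c) atom set"

definition replace :: "'c trm \<Rightarrow> 'c trm \<Rightarrow> ('r,'c) atom set \<Rightarrow> ('r,'c) atom set" where
  "replace s t I = (\<lambda>(r,ts). (r, map (\<lambda>u. if u = s then t else u) ts)) ` I"

fun egd_result :: "('r,'c) atom set \<Rightarrow> 'c trm \<Rightarrow> 'c trm \<Rightarrow> ('r,'c) st" where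
  "egd_result I (Nul m) (Nul n) = Inst (replace (Nul (max m n)) (Nul (min m n)) I)"
| "egd_result I (Nul n) (Cst c) = Inst (replace (Nul n) (Cst c) I)"
| "egd_result I (Cst c) (Nul n) = Inst (replace (Nul n) (Cst c) I)"
| "egd_result I (Cst c) (Cst d) = (if c = d then Inst I else Fail)"

fun fire :: "('r,'c) atom set \<Rightarrow> ('r,'c) dep \<Rightarrow> (nat \<Rightarrow> 'c trm) \<Rightarrow> ('r,'c) st \<Rightarrow> bool" where
  "fire I (TGD b hs) h S \<longleftrightarrow>
     (\<exists>h'. fresh_ext I (TGD b hs) h h' \<and> S = Inst (I \<union> inst h' hs))"
| "fire I (EGD b x y) h S \<longleftrightarrow> S = egd_result I (h x) (h y)"

definition hom :: "('c trm \<Rightarrow> 'c trm) \<Rightarrow> ('r,'c) atom set \<Rightarrow> ('r,'c) atom set \<Rightarrow> bool" where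
  "hom f A B \<longleftrightarrow> (\<forall>c. f (Cst c) = Cst c) \<and> (\<lambda>(r,ts). (r, map f ts)) ` A \<subseteq> B"

definition is_core_of :: "('r,'c) atom set \<Rightarrow> ('r,'c) atom set \<Rightarrow> bool" where
  "is_core_of J C \<longleftrightarrow> C \<subseteq> J \<and> (\<exists>f. hom f J C) \<and> \<not> (\<exists>C' f. C' \<subset> C \<and> hom f C C')"

definition parallel :: "('r,'c) dep set \<Rightarrow> ('r,'c) atom set \<Rightarrow> ('r,'c) atom set \<Rightarrow> bool" where
  "parallel \<Sigma> I J \<longleftrightarrow>
    (let K = {(\<xi>, restr h (bvars \<xi>)) | \<xi> h. \<xi> \<in> \<Sigma> \<and> is_tgd \<xi> \<and> is_trigger I \<xi> h \<and> active I \<xi> h}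
     in \<exists>ext. (\<forall>k\<in>K. (\<forall>v\<in>bvars (fst k). snd k v = Some (ext k v))
                      \<and> fresh_ext I (fst k) (ext k) (ext k))
           \<and> (\<forall>k\<in>K. \<forall>k'\<in>K. k \<noteq> k' \<longrightarrow> ext k ` evars (fst k) \<inter> ext k' ` evars (fst k') = {})
           \<and> J = I \<union> (\<Union>k\<in>K. inst (ext k) (heads (fst k))))"

datatype variant = Std | Obl | Sobl | CoreV

type_synonym ('r,'c) config = "('r,'c) st \<times> (('r,'c) dep \<times> (nat \<Rightarrow> 'c trm option)) set"

fun step :: "variant \<Rightarrow> ('r,'c) dep set \<Rightarrow> ('r,'c) config \<Rightarrow> ('r,'c) config \<Rightarrow> bool" where
  "step _ _ (Fail, _) _ = False"
| "step Std \<Sigma> (Inst I, H) (S', H') \<longleftrightarrow>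
     H' = H \<and> (\<exists>\<xi>\<in>\<Sigma>. \<exists>h. is_trigger I \<xi> h \<and> active I \<xi> h \<and> fire I \<xi> h S')"
| "step Obl \<Sigma> (Inst I, H) (S', H') \<longleftrightarrow>
     (\<exists>\<xi>\<in>\<Sigma>. \<exists>h. is_trigger I \<xi> h \<and> (\<xi>, restr h (bvars \<xi>)) \<notin> H \<and> fire I \<xi> h S'
        \<and> H' = insert (\<xi>, restr h (bvars \<xi>)) H)"
| "step Sobl \<Sigma> (Inst I, H) (S', H') \<longleftrightarrow>
     (\<exists>\<xi>\<in>\<Sigma>. \<exists>h. is_trigger I \<xi> h \<and> (\<xi>, restr h (key_vars \<xi>)) \<notin> H \<and> fire I \<xi> h S'
        \<and> H' = insert (\<xi>, restr h (key_vars \<xi>)) H)"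
| "step CoreV \<Sigma> (Inst I, H) (S', H') \<longleftrightarrow> H' = H \<and>
     ((\<exists>\<xi>\<in>\<Sigma>. \<exists>h. \<not> is_tgd \<xi> \<and> is_trigger I \<xi> h \<and> active I \<xi> h \<and> fire I \<xi> h S')
      \<or> (\<not> (\<exists>\<xi>\<in>\<Sigma>. \<exists>h. \<not> is_tgd \<xi> \<and> is_trigger I \<xi> h \<and> active I \<xi> h)
         \<and> (\<exists>\<xi>\<in>\<Sigma>. \<exists>h. is_tgd \<xi> \<and> is_trigger I \<xi> h \<and> active I \<xi> h)
         \<and> (\<exists>J C. parallel \<Sigma> I J \<and> is_core_of J C \<and> S' = Inst C)))"

definition terminates :: "variant \<Rightarrow> ('r,'c) dep set \<Rightarrow> ('r,'c) atom set \<Rightarrow> bool" where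
  "terminates v \<Sigma> I \<longleftrightarrow>
     \<not> (\<exists>f :: nat \<Rightarrow> ('r,'c) config. f 0 = (Inst I, {}) \<and> (\<forall>n. step v \<Sigma> (f n) (f (Suc n))))"

text \<open>Congruence rule for relation R of arity n at position i (0-based, i < n):
  variables 0..n-1 are x_1..x_n, variable n is x, variable n+1 is y.\<close>
definition repl_rule :: "'r \<Rightarrow> 'r \<Rightarrow> nat \<Rightarrow> nat \<Rightarrow> ('r,'c) dep" where
  "repl_rule E R n i =
     TGD [(E, [RVar n, RVar (Suc n)]), (R, map (\<lambda>j. if j = i then RVar n else RVar j) [0..<n])]
         [(R, map (\<lambda>j. if j = i then RVar (Suc n) else RVar j) [0..<n])]"

definition sigma_tgd :: "'r \<Rightarrow> ('r \<Rightarrow> nat) \<Rightarrow> ('r,'c) dep set \<Rightarrow> ('r,'c) dep set" where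
  "sigma_tgd E ar \<Sigma> =
      {\<xi> \<in> \<Sigma>. is_tgd \<xi>}
    \<union> {TGD b [(E, [RVar x, RVar y]), (E, [RVar y, RVar x])] | b x y. EGD b x y \<in> \<Sigma>}
    \<union> {repl_rule E R (ar R) i | R i. R \<in> rels_of \<Sigma> \<and> i < ar R}"

definition wf_dep :: "('r \<Rightarrow> nat) \<Rightarrow> ('r,'c) dep \<Rightarrow> bool" where
  "wf_dep ar \<xi> \<longleftrightarrow> (\<forall>(R,ts)\<in>set (body \<xi>) \<union> set (heads \<xi>). length ts = ar R)
     \<and> (\<forall>b x y. \<xi> = EGD b x y \<longrightarrow> x \<in> avars b \<and> y \<in> avars b)"

end

theory Submission
  imports Defs "HOL-Library.Nat_Bijection" "HOL-Combinatorics.Cycles"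
begin

text \<open>
  For the standard, oblivious and semi-oblivious chase, a \<open>\<Sigma>\<close>-chase sequence is simulated by a
  chase sequence with the translated tgds: an instance of the \<open>\<Sigma>\<close>-chase is kept as the quotient,
  modulo \<open>E\<close>, of an instance that is saturated under the congruence rules. Saturation lets triggers
  be lifted from the quotient, and every step of the \<open>\<Sigma>\<close>-chase except trivial egd steps becomes a
  genuine step upstairs.

  For the core chase, a terminated chase with the translated tgds yields a model \<open>J\<close>. It maps into
  some stage of any infinite core chase with \<open>\<Sigma>\<close>, with \<open>E\<close> interpreted as equality there. Hence
  \<open>J / E\<close> is a model of \<open>\<Sigma>\<close> which is homomorphically equivalent to all later stages. A core that
  is homomorphically equivalent to a model is a model, so the chase stops there.
\<close>

section \<open>Instances and homomorphisms\<close>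

text \<open>Termination is used as accessibility of the start configuration. Induction along the
  translated chase then allows any applicable step to be taken, so saturation needs no termination
  argument of its own: every missing congruence conclusion is itself such a step. The obstacle for
  the logging variants is that an egd step renames terms in the instance but not in the recorded
  keys. Current values alone therefore cannot relate the two histories, and a second map remembering
  original names is carried along. The core chase resists step-by-step simulation, because a step
  fires all active triggers at once and the retraction to a core may discard terms on one side only.
  Hence only homomorphisms are compared there. Reading \<open>E\<close> as equality is sound only at
  stages where all egds hold; such stages recur, since each egd step removes a null. Finally,
  \<open>E\<close> has neither reflexivity nor transitivity rules, so classes modulo
  \<open>E\<close> are taken along paths.\<close>

definition adom :: "('r,'c) atom set \<Rightarrow> 'c trm set" where
  "adom I = (\<Union>a\<in>I. set (snd a))"

text \<open>All constants are included, whether or not they occur in \<open>I\<close>: a tgd head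
  may mention a constant that the instance does not yet contain.\<close>

definition dm :: "('r,'c) atom set \<Rightarrow> 'c trm set" where
  "dm I = range Cst \<union> adom I"

lemma nulls_of_iff: "n \<in> nulls_of I \<longleftrightarrow> Nul n \<in> adom I"
  by (auto simp: nulls_of_def adom_def)

lemma adomI: "(R, ts) \<in> I \<Longrightarrow> t \<in> set ts \<Longrightarrow> t \<in> adom I"
  by (force simp: adom_def)

lemma adomE:
  assumes "t \<in> adom I"
  obtains R ts where "(R, ts) \<in> I" "t \<in> set ts"
  using assms by (auto simp: adom_def)

lemma adom_Un: "adom (I \<union> J) = adom I \<union> adom J"
  by (auto simp: adom_def)

lemma Cst_in_dm [simp]: "Cst c \<in> dm I"
  by (simp add: dm_def)

lemma Nul_in_dm_iff: "Nul n \<in> dm I \<longleftrightarrow> n \<in> nulls_of I"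
  by (auto simp: dm_def nulls_of_iff)

lemma finite_adom: "finite I \<Longrightarrow> finite (adom I)"
  by (simp add: adom_def)

lemma finite_nulls_of:
  fixes I :: "('r,'c) atom set"
  assumes "finite I"
  shows "finite (nulls_of I)"
proof -
  have "nulls_of I = Nul -` adom I"
    by (auto simp: nulls_of_iff)
  moreover have "inj (Nul :: nat \<Rightarrow> 'c trm)"
    by (simp add: inj_def)
  ultimately show ?thesis
    using finite_vimageI[OF finite_adom[OF assms]] by metis
qed

lemma hom_iff:
  "hom f A B \<longleftrightarrow> (\<forall>c. f (Cst c) = Cst c) \<and> (\<forall>R ts. (R, ts) \<in> A \<longrightarrow> (R, map f ts) \<in> B)"
  by (auto simp: hom_def)

lemma hom_Cst: "hom f A B \<Longrightarrow> f (Cst c) = Cst c"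
  by (simp add: hom_iff)

lemma hom_atom: "hom f A B \<Longrightarrow> (R, ts) \<in> A \<Longrightarrow> (R, map f ts) \<in> B"
  by (simp add: hom_iff)

lemma hom_subset: "hom f A B \<Longrightarrow> A' \<subseteq> A \<Longrightarrow> B \<subseteq> B' \<Longrightarrow> hom f A' B'"
  unfolding hom_iff by blast

lemma hom_id: "A \<subseteq> B \<Longrightarrow> hom id A B"
  by (auto simp: hom_iff)

lemma hom_comp:
  assumes "hom f A B" "hom g B C"
  shows "hom (g \<circ> f) A C"
  unfolding hom_iff
proof (intro conjI allI impI)
  fix c show "(g \<circ> f) (Cst c) = Cst c"
    using assms by (simp add: hom_Cst)
next
  fix R ts assume "(R, ts) \<in> A"
  then have "(R, map g (map f ts)) \<in> C"
    using assms hom_atom by metis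
  then show "(R, map (g \<circ> f) ts) \<in> C"
    by simp
qed

lemma inst_subset_iff: "inst h as \<subseteq> I \<longleftrightarrow> (\<forall>R ts. (R, ts) \<in> set as \<longrightarrow> (R, map (inst_t h) ts) \<in> I)"
  by (auto simp: inst_def)

lemma inst_memI: "(R, ts) \<in> set as \<Longrightarrow> (R, map (inst_t h) ts) \<in> inst h as"
  by (force simp: inst_def)

lemma inst_memE:
  assumes "(R, us) \<in> inst h as"
  obtains ts where "(R, ts) \<in> set as" "us = map (inst_t h) ts"
  using assms by (auto simp: inst_def)

lemma finite_inst: "finite (inst h as)"
  by (simp add: inst_def)

lemma rvars_subset_avars: "(R, ts) \<in> set as \<Longrightarrow> t \<in> set ts \<Longrightarrow> rvars t \<subseteq> avars as"
  by (force simp: avars_def)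

lemma finite_avars: "finite (avars (as :: ('r,'c) ratom list))"
proof -
  have "finite (rvars t)" for t :: "'c rtrm"
    by (cases t) auto
  then show ?thesis
    by (simp add: avars_def)
qed

lemma inst_t_cong: "(\<And>v. v \<in> rvars t \<Longrightarrow> h v = h' v) \<Longrightarrow> inst_t h t = inst_t h' t"
  by (cases t) auto

lemma map_inst_t_cong:
  assumes "(R, ts) \<in> set as" "\<And>v. v \<in> avars as \<Longrightarrow> h v = h' v"
  shows "map (inst_t h) ts = map (inst_t h') ts"
  using assms rvars_subset_avars by (fastforce intro: inst_t_cong)

lemma inst_cong:
  assumes "\<And>v. v \<in> avars as \<Longrightarrow> h v = h' v"
  shows "inst h as = inst h' as"
  unfolding inst_def
proof (intro image_cong refl)
  fix a assume "a \<in> set as"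
  then show "(\<lambda>(r, ts). (r, map (inst_t h) ts)) a = (\<lambda>(r, ts). (r, map (inst_t h') ts)) a"
    using map_inst_t_cong[of _ _ as h h'] assms by (auto split: prod.split)
qed

lemma inst_t_comp: "(\<And>c. f (Cst c) = Cst c) \<Longrightarrow> inst_t (f \<circ> h) t = f (inst_t h t)"
  by (cases t) auto

lemma inst_comp_atom:
  assumes "\<And>c. f (Cst c) = Cst c" "\<And>v. v \<in> avars as \<Longrightarrow> h' v = f (h v)" "(R, ts) \<in> set as"
  shows "map (inst_t h') ts = map f (map (inst_t h) ts)"
proof -
  have "map (inst_t h') ts = map (inst_t (f \<circ> h)) ts"
    using assms by (intro map_inst_t_cong[of R ts as]) auto
  also have "\<dots> = map f (map (inst_t h) ts)"
    using inst_t_comp[of f h] assms(1) by simp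
  finally show ?thesis .
qed

lemma inst_hom:
  assumes f: "hom f A B" and A: "inst h as \<subseteq> A" and eq: "\<And>v. v \<in> avars as \<Longrightarrow> h' v = f (h v)"
  shows "inst h' as \<subseteq> B"
  unfolding inst_subset_iff
proof (intro allI impI)
  fix R ts assume ts: "(R, ts) \<in> set as"
  have "(R, map f (map (inst_t h) ts)) \<in> B"
    using A ts f by (auto simp: inst_subset_iff intro!: hom_atom simp del: map_map)
  then show "(R, map (inst_t h') ts) \<in> B"
    using inst_comp_atom[of f as h' h R ts] eq ts hom_Cst[OF f] by metis
qed

lemma avars_in_adom:
  assumes "v \<in> avars as" "inst h as \<subseteq> I"
  shows "h v \<in> adom I"
proof -
  obtain R ts t where "(R, ts) \<in> set as" "t \<in> set ts" "v \<in> rvars t"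
    using assms(1) by (auto simp: avars_def)
  moreover from this have "inst_t h t = h v"
    by (cases t) auto
  ultimately show ?thesis
    using assms(2) by (force simp: inst_subset_iff intro!: adomI)
qed

lemma adom_inst: "adom (inst h as) \<subseteq> range Cst \<union> h ` avars as"
proof
  fix t assume "t \<in> adom (inst h as)"
  then obtain R us where us: "(R, us) \<in> inst h as" "t \<in> set us"
    by (rule adomE)
  then obtain ts u where ts: "(R, ts) \<in> set as" "u \<in> set ts" "t = inst_t h u"
    by (auto elim!: inst_memE)
  then show "t \<in> range Cst \<union> h ` avars as"
    using rvars_subset_avars[OF ts(1,2)] by (cases u) auto
qed

lemma inst_rels:
  assumes "\<xi> \<in> \<Sigma>" "(R, us) \<in> inst h (body \<xi>) \<union> inst h (heads \<xi>)"
  shows "R \<in> rels_of \<Sigma>"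
  using assms by (auto simp: rels_of_def inst_def)

lemma finite_bvars: "finite (bvars \<xi>)"
  by (simp add: bvars_def finite_avars)

lemma restr_eq_iff: "restr h V = restr h' V \<longleftrightarrow> (\<forall>v\<in>V. h v = h' v)"
  by (force simp: restr_def fun_eq_iff)

text \<open>Mappings are total functions, so only their restrictions can be finitely many: each is a
  map from the finite set \<open>V \<xi>\<close> into \<open>adom I\<close>.\<close>

lemma finite_trigger_keys:
  assumes "finite \<Sigma>" "finite I" "\<And>\<xi>. V \<xi> \<subseteq> bvars \<xi>"
  shows "finite {(\<xi>, restr h (V \<xi>)) | \<xi> h. \<xi> \<in> \<Sigma> \<and> is_trigger I \<xi> h}" (is "finite ?K")
proof (rule finite_subset)
  let ?M = "\<lambda>\<xi>. {m. dom m = V \<xi> \<and> ran m \<subseteq> adom I}"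
  show "?K \<subseteq> (\<Union>\<xi>\<in>\<Sigma>. Pair \<xi> ` ?M \<xi>)"
  proof
    fix k assume "k \<in> ?K"
    then obtain \<xi> h where k: "k = (\<xi>, restr h (V \<xi>))" "\<xi> \<in> \<Sigma>" "is_trigger I \<xi> h"
      by auto
    have "ran (restr h (V \<xi>)) \<subseteq> adom I"
      using k(3) assms(3)[of \<xi>] avars_in_adom
      by (fastforce simp: ran_def restr_def is_trigger_def bvars_def split: if_splits)
    moreover have "dom (restr h (V \<xi>)) = V \<xi>"
      by (auto simp: dom_def restr_def)
    ultimately show "k \<in> (\<Union>\<xi>\<in>\<Sigma>. Pair \<xi> ` ?M \<xi>)"
      using k by auto
  qed
  have "finite (V \<xi>)" for \<xi>
    using finite_bvars assms(3) finite_subset by metis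
  then show "finite (\<Union>\<xi>\<in>\<Sigma>. Pair \<xi> ` ?M \<xi>)"
    using assms(1,2) by (auto intro!: finite_set_of_finite_maps finite_adom)
qed

text \<open>Hides the order on nulls and the preference for constants. Later arguments only use that
  a null among the two terms is replaced by the other term.\<close>

lemma egd_result_cases:
  assumes "s \<noteq> t"
  obtains "egd_result I s t = Fail"
  | n w where "egd_result I s t = Inst (replace (Nul n) w I)" "{Nul n, w} = {s, t}" "w \<noteq> Nul n"
proof (cases s)
  case (Cst c)
  then show ?thesis
    using assms that by (cases t) auto
next
  case (Nul m)
  note s = this
  show ?thesis
  proof (cases t)
    case (Cst d)
    then show ?thesis
      using s that(2)[of m "Cst d"] by auto
  next
    case (Nul k)
    then show ?thesis
      using s assms that(2)[of "max m k" "Nul (min m k)"]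
      by (cases "m \<le> k") (auto simp: max_def min_def)
  qed
qed

lemma egd_result_same: "egd_result I s s = Inst I"
proof -
  have "replace s s I = I"
    by (auto simp: replace_def)
  then show ?thesis
    by (cases s) auto
qed

section \<open>Saturation under the congruence rules\<close>

text \<open>Only the symmetric part of \<open>E\<close> is used: no rule forces \<open>E\<close> to be symmetric, but the
  translated egds always add both orientations.\<close>
definition Erel :: "'r \<Rightarrow> ('r,'c) atom set \<Rightarrow> ('c trm \<times> 'c trm) set" where
  "Erel E J = {(s, t). (E, [s, t]) \<in> J \<and> (E, [t, s]) \<in> J}"

definition saturated :: "'r \<Rightarrow> ('r \<Rightarrow> nat) \<Rightarrow> 'r set \<Rightarrow> ('r,'c) atom set \<Rightarrow> bool" where
  "saturated E ar \<R> J \<longleftrightarrow> (\<forall>R\<in>\<R>. \<forall>us i t. (R, us) \<in> J \<longrightarrow> length us = ar R \<longrightarrow> i < ar R \<longrightarrow>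
     (us ! i, t) \<in> Erel E J \<longrightarrow> (R, us[i := t]) \<in> J)"

lemma Erel_rtrancl_sym: "(s, t) \<in> (Erel E J)\<^sup>* \<Longrightarrow> (t, s) \<in> (Erel E J)\<^sup>*"
proof -
  have "sym (Erel E J)"
    by (auto simp: sym_def Erel_def)
  then show "(s, t) \<in> (Erel E J)\<^sup>* \<Longrightarrow> (t, s) \<in> (Erel E J)\<^sup>*"
    by (metis sym_rtrancl symD)
qed

text \<open>The congruence rules replace a term along one edge of \<open>E\<close>; a path is
  followed edge by edge at a fixed position.\<close>

lemma saturated_update:
  assumes sat: "saturated E ar \<R> J" and R: "R \<in> \<R>"
    and us: "(R, us) \<in> J" "length us = ar R" "i < ar R"
    and st: "(us ! i, t) \<in> (Erel E J)\<^sup>*"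
  shows "(R, us[i := t]) \<in> J"
  using st
proof (induction rule: rtrancl_induct)
  case base
  then show ?case using us by simp
next
  case (step y z)
  have "(R, us[i := y, i := z]) \<in> J"
    using sat R step us unfolding saturated_def by (metis length_list_update nth_list_update_eq)
  then show ?case by simp
qed

lemma saturated_list:
  assumes sat: "saturated E ar \<R> J" and R: "R \<in> \<R>"
    and us: "(R, us) \<in> J" "length us = ar R" "length ts = ar R"
    and st: "\<And>i. i < ar R \<Longrightarrow> (us ! i, ts ! i) \<in> (Erel E J)\<^sup>*"
  shows "(R, ts) \<in> J"
proof -
  \<comment> \<open>Positions are exchanged from left to right; the first \<open>k\<close> entries
    are already those of \<open>ts\<close>.\<close>
  have "(R, take k ts @ drop k us) \<in> J" if "k \<le> ar R" for k
    using that
  proof (induction k)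
    case 0
    then show ?case using us by simp
  next
    case (Suc k)
    then have k: "k < ar R" by simp
    let ?us = "take k ts @ drop k us"
    have "?us[k := ts ! k] = take (Suc k) ts @ drop (Suc k) us"
    proof -
      have "drop k us = us ! k # drop (Suc k) us"
        using k us by (simp add: Cons_nth_drop_Suc)
      then show ?thesis
        using k us by (simp add: list_update_append take_Suc_conv_app_nth)
    qed
    moreover have "?us ! k = us ! k"
      using k us by (simp add: nth_append)
    ultimately show ?case
      using saturated_update[OF sat R, of ?us k "ts ! k"] Suc k us st by simp
  qed
  from this[of "ar R"] show ?thesis
    using us by simp
qed

text \<open>Each body atom has a preimage in \<open>J\<close>, but a variable shared by several
  atoms may have a different preimage in each. All of them have the same \<open>q\<close>-value as
  the chosen \<open>g v\<close>, so they are joined to it by \<open>E\<close>-paths, and saturation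
  rewrites every atom to the common choice. Leaving \<open>g\<close> free lets the caller select
  suitable representatives.\<close>

lemma lift_trigger:
  assumes sat: "saturated E ar (rels_of \<Sigma>) J"
    and \<xi>: "\<xi> \<in> \<Sigma>" "wf_dep ar \<xi>"
    and q: "\<And>c. q (Cst c) = Cst c"
    and conn: "\<And>s t. s \<in> dm J \<Longrightarrow> t \<in> dm J \<Longrightarrow> q s = q t \<Longrightarrow> (s, t) \<in> (Erel E J)\<^sup>*"
    and I: "\<And>R us. (R, us) \<in> I \<Longrightarrow> \<exists>ws. (R, ws) \<in> J \<and> us = map q ws"
    and h: "is_trigger I \<xi> h"
    and g: "\<And>v. v \<in> bvars \<xi> \<Longrightarrow> g v \<in> dm J \<and> q (g v) = h v"
  shows "is_trigger J \<xi> g"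
  unfolding is_trigger_def inst_subset_iff
proof (intro allI impI)
  fix R ts assume ts: "(R, ts) \<in> set (body \<xi>)"
  have R: "R \<in> rels_of \<Sigma>"
    using ts \<xi> by (auto simp: rels_of_def)
  have len: "length ts = ar R"
    using ts \<xi> by (auto simp: wf_dep_def)
  have "(R, map (inst_t h) ts) \<in> I"
    using h ts by (simp add: is_trigger_def inst_subset_iff)
  then obtain ws where ws: "(R, ws) \<in> J" "map (inst_t h) ts = map q ws"
    using I by blast
  have lw: "length ws = ar R"
    using ws(2) len map_eq_imp_length_eq by metis
  show "(R, map (inst_t g) ts) \<in> J"
  proof (rule saturated_list[OF sat R ws(1) lw])
    show "length (map (inst_t g) ts) = ar R" using len by simp
    fix i assume i: "i < ar R"
    have dmw: "ws ! i \<in> dm J"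
      using ws(1) i lw by (auto simp: dm_def intro: adomI)
    have vs: "rvars (ts ! i) \<subseteq> bvars \<xi>"
      using rvars_subset_avars[OF ts] i len by (simp add: bvars_def)
    have "inst_t g (ts ! i) \<in> dm J \<and> q (inst_t g (ts ! i)) = inst_t h (ts ! i)"
      using vs g q by (cases "ts ! i") auto
    moreover have "inst_t h (ts ! i) = q (ws ! i)"
      using ws(2) i len lw by (metis nth_map)
    ultimately show "(ws ! i, map (inst_t g) ts ! i) \<in> (Erel E J)\<^sup>*"
      using conn dmw i len by simp
  qed
qed

section \<open>Chase steps\<close>

lemma accp_no_infinite_chain:
  assumes "Wellfounded.accp r x"
  shows "\<not> (\<exists>f :: nat \<Rightarrow> _. f 0 = x \<and> (\<forall>n. r (f (Suc n)) (f n)))"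
  using assms
proof (induction rule: accp.induct)
  fix x
  assume IH: "\<And>y. r y x \<Longrightarrow> \<not> (\<exists>f :: nat \<Rightarrow> _. f 0 = y \<and> (\<forall>n. r (f (Suc n)) (f n)))"
  show "\<not> (\<exists>f :: nat \<Rightarrow> _. f 0 = x \<and> (\<forall>n. r (f (Suc n)) (f n)))"
  proof
    assume "\<exists>f :: nat \<Rightarrow> _. f 0 = x \<and> (\<forall>n. r (f (Suc n)) (f n))"
    then obtain f where f: "f 0 = x" "\<And>n :: nat. r (f (Suc n)) (f n)" by blast
    then have "r (f (Suc 0)) x" by metis
    moreover have "\<exists>g :: nat \<Rightarrow> _. g 0 = f (Suc 0) \<and> (\<forall>n. r (g (Suc n)) (g n))"
      using f(2) by (intro exI[of _ "\<lambda>n :: nat. f (Suc n)"]) simp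
    ultimately show False
      using IH by blast
  qed
qed

lemma terminates_iff_accp:
  fixes \<Sigma> :: "('r,'c) dep set"
  shows "terminates v \<Sigma> I \<longleftrightarrow> Wellfounded.accp (\<lambda>y x. step v \<Sigma> x y) (Inst I, {})"
proof
  assume T: "terminates v \<Sigma> I"
  show "Wellfounded.accp (\<lambda>y x. step v \<Sigma> x y) (Inst I, {})"
  proof (rule ccontr)
    let ?r = "\<lambda>y x :: ('r,'c) config. step v \<Sigma> x y"
    assume na: "\<not> Wellfounded.accp ?r (Inst I, {})"
    have "\<exists>f :: nat \<Rightarrow> ('r,'c) config. \<forall>n. (\<not> Wellfounded.accp ?r (f n) \<and> (n = 0 \<longrightarrow> f n = (Inst I, {}))) \<and> ?r (f (Suc n)) (f n)"
    proof (rule dependent_nat_choice)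
      show "\<exists>x. \<not> Wellfounded.accp ?r x \<and> ((0::nat) = 0 \<longrightarrow> x = (Inst I, {}))"
        using na by blast
    next
      fix x and n :: nat assume "\<not> Wellfounded.accp ?r x \<and> (n = 0 \<longrightarrow> x = (Inst I, {}))"
      then obtain z where "?r z x" "\<not> Wellfounded.accp ?r z"
        by (meson not_accp_down)
      then show "\<exists>y. (\<not> Wellfounded.accp ?r y \<and> (Suc n = 0 \<longrightarrow> y = (Inst I, {}))) \<and> ?r y x"
        by (intro exI[of _ z]) simp
    qed
    then show False
      using T unfolding terminates_def by blast
  qed
next
  assume "Wellfounded.accp (\<lambda>y x. step v \<Sigma> x y) (Inst I, {})"
  from accp_no_infinite_chain[OF this] show "terminates v \<Sigma> I"
    unfolding terminates_def .
qed

section \<open>A uniform view of the standard, oblivious and semi-oblivious variants\<close>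

definition kv :: "variant \<Rightarrow> ('r,'c) dep \<Rightarrow> nat set" where
  "kv v \<xi> = (if v = Obl then bvars \<xi> else key_vars \<xi>)"

definition applicable :: "variant \<Rightarrow> ('r,'c) atom set \<Rightarrow> (('r,'c) dep \<times> (nat \<Rightarrow> 'c trm option)) set \<Rightarrow>
    ('r,'c) dep \<Rightarrow> (nat \<Rightarrow> 'c trm) \<Rightarrow> bool" where
  "applicable v I H \<xi> h \<longleftrightarrow> (if v = Std then active I \<xi> h else (\<xi>, restr h (kv v \<xi>)) \<notin> H)"

definition log_trigger :: "variant \<Rightarrow> (('r,'c) dep \<times> (nat \<Rightarrow> 'c trm option)) set \<Rightarrow>
    ('r,'c) dep \<Rightarrow> (nat \<Rightarrow> 'c trm) \<Rightarrow> (('r,'c) dep \<times> (nat \<Rightarrow> 'c trm option)) set" where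
  "log_trigger v H \<xi> h = (if v = Std then H else insert (\<xi>, restr h (kv v \<xi>)) H)"

lemma step_non_core:
  assumes "v \<noteq> CoreV"
  shows "step v \<Sigma> (Inst I, H) (S', H') \<longleftrightarrow>
    (\<exists>\<xi>\<in>\<Sigma>. \<exists>h. is_trigger I \<xi> h \<and> applicable v I H \<xi> h \<and> fire I \<xi> h S' \<and> H' = log_trigger v H \<xi> h)"
  using assms by (cases v) (auto simp: applicable_def log_trigger_def kv_def)

lemma kv_subset_bvars: "kv v \<xi> \<subseteq> bvars \<xi>"
  by (cases \<xi>) (auto simp: kv_def bvars_def)

text \<open>For a tgd without existential variables, even the semi-oblivious key determines the
  image of the whole head. Two triggers with the same key thus produce the same atoms.\<close>

lemma kv_full: "avars hs \<subseteq> avars b \<Longrightarrow> avars hs \<subseteq> kv v (TGD b hs)"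
  by (auto simp: kv_def bvars_def)

lemma fire_full:
  assumes "avars hs \<subseteq> avars b"
  shows "fire J (TGD b hs) g (Inst (J \<union> inst g hs))"
proof -
  have "evars (TGD b hs) = {}"
    using assms by (auto simp: evars_def)
  then show ?thesis
    by (auto simp: fresh_ext_def intro!: exI[of _ g])
qed

lemma active_full:
  assumes "avars hs \<subseteq> avars b"
  shows "active J (TGD b hs) g \<longleftrightarrow> \<not> inst g hs \<subseteq> J"
proof -
  have "inst h' hs = inst g hs" if "\<forall>v\<in>avars b. h' v = g v" for h'
    using that assms by (intro inst_cong) auto
  then show ?thesis unfolding active.simps by metis
qed

locale dependencies =
  fixes \<Sigma> :: "('r,'c) dep set" and ar :: "'r \<Rightarrow> nat" and E :: 'r
  assumes finite_\<Sigma>: "finite \<Sigma>"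
    and wf: "\<xi> \<in> \<Sigma> \<Longrightarrow> wf_dep ar \<xi>"
    and E_new: "E \<notin> rels_of \<Sigma>"
begin

abbreviation "\<Sigma>t \<equiv> sigma_tgd E ar \<Sigma>"

lemma rel_not_E: "\<xi> \<in> \<Sigma> \<Longrightarrow> (R, ts) \<in> set (body \<xi>) \<union> set (heads \<xi>) \<Longrightarrow> R \<noteq> E"
  using E_new by (auto simp: rels_of_def)

lemma inst_not_E: "\<xi> \<in> \<Sigma> \<Longrightarrow> (R, us) \<in> inst h (body \<xi>) \<union> inst h (heads \<xi>) \<Longrightarrow> R \<noteq> E"
  using E_new inst_rels by metis

lemma egd_vars: "EGD b x y \<in> \<Sigma> \<Longrightarrow> x \<in> avars b \<and> y \<in> avars b"
  using wf[of "EGD b x y"] by (simp add: wf_dep_def)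

lemma sigma_tgd_tgd: "\<xi> \<in> \<Sigma> \<Longrightarrow> is_tgd \<xi> \<Longrightarrow> \<xi> \<in> \<Sigma>t"
  and sigma_tgd_egd: "EGD b x y \<in> \<Sigma> \<Longrightarrow> TGD b [(E, [RVar x, RVar y]), (E, [RVar y, RVar x])] \<in> \<Sigma>t"
  and sigma_tgd_repl: "R \<in> rels_of \<Sigma> \<Longrightarrow> i < ar R \<Longrightarrow> repl_rule E R (ar R) i \<in> \<Sigma>t"
  by (auto simp: sigma_tgd_def)

text \<open>Together with \<open>repl_rule_notin\<close>, this keeps the log entries of auxiliary
  rules out of the comparison of histories, which concerns tgds of \<Sigma> only.\<close>

lemma egd_tgd_notin: "TGD b [(E, [RVar x, RVar y]), (E, [RVar y, RVar x])] \<notin> \<Sigma>"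
  using rel_not_E[of "TGD b [(E, [RVar x, RVar y]), (E, [RVar y, RVar x])]" E] by auto

lemma repl_rule_notin: "repl_rule E R n i \<notin> \<Sigma>"
  using rel_not_E[of "repl_rule E R n i" E] by (auto simp: repl_rule_def)

lemma repl_rule_full:
  assumes "repl_rule E R n i = TGD b hs"
  shows "avars hs \<subseteq> avars b"
  using assms by (auto simp: repl_rule_def avars_def split: if_splits)

lemma repl_trigger:
  assumes "length us = n" "i < n"
  shows "\<exists>h. inst h (body (repl_rule E R n i)) = {(E, [us ! i, t]), (R, us)}
    \<and> inst h (heads (repl_rule E R n i)) = {(R, us[i := t])}"
proof -
  \<comment> \<open>Variable \<open>n\<close> carries the old entry at position \<open>i\<close>,
    and variable \<open>Suc n\<close> falls under the default value \<open>t\<close>.\<close>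
  let ?h = "\<lambda>j. if j < n then us ! j else if j = n then us ! i else t"
  have "map (inst_t ?h) (map (\<lambda>j. if j = i then RVar n else RVar j) [0..<n]) = us"
    using assms by (intro nth_equalityI) auto
  moreover have "map (inst_t ?h) (map (\<lambda>j. if j = i then RVar (Suc n) else RVar j) [0..<n]) = us[i := t]"
    using assms by (intro nth_equalityI) (auto simp: nth_list_update)
  ultimately show ?thesis
    by (intro exI[of _ ?h]) (simp add: repl_rule_def inst_def del: map_map)
qed

end

section \<open>Simulating the standard, oblivious and semi-oblivious chase\<close>

text \<open>
  The map \<open>q\<close> sends a term of \<open>J\<close> to its current merged value in \<open>I\<close>, whereas \<open>N\<close> records the
  value that a term had when it was introduced. Every value of \<open>I\<close> is represented by a term on
  which \<open>q\<close> and \<open>N\<close> agree; since \<open>N\<close> never changes, a trigger of \<open>\<Sigma>\<close> lifted to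
  such representatives can only have been fired before if the original one was. Names of merged
  nulls may be reused as fresh nulls, hence \<open>N\<close> need not be the identity.
\<close>

locale simulation = dependencies \<Sigma> ar E
  for \<Sigma> :: "('r,'c) dep set" and ar :: "'r \<Rightarrow> nat" and E :: 'r +
  fixes v :: variant and J :: "('r,'c) atom set" and G :: "(('r,'c) dep \<times> (nat \<Rightarrow> 'c trm option)) set"
    and I :: "('r,'c) atom set" and H :: "(('r,'c) dep \<times> (nat \<Rightarrow> 'c trm option)) set"
    and q N :: "'c trm \<Rightarrow> 'c trm"
  assumes finite_J: "finite J"
    and q_Cst: "q (Cst c) = Cst c"
    and N_Cst: "N (Cst c) = Cst c"
    and mem_I: "(R, us) \<in> I \<longleftrightarrow> R \<noteq> E \<and> (\<exists>ws. (R, ws) \<in> J \<and> us = map q ws)"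
    and E_q: "(E, [s, t]) \<in> J \<Longrightarrow> q s = q t"
    and conn: "s \<in> dm J \<Longrightarrow> t \<in> dm J \<Longrightarrow> q s = q t \<Longrightarrow> (s, t) \<in> (Erel E J)\<^sup>*"
    and q_dm: "s \<in> dm J \<Longrightarrow> q s \<in> dm I"
    and rep: "a \<in> dm I \<Longrightarrow> \<exists>s\<in>dm J. q s = a \<and> N s = a"
    and hist: "\<xi> \<in> \<Sigma> \<Longrightarrow> is_tgd \<xi> \<Longrightarrow> (\<xi>, g) \<in> G \<Longrightarrow> (\<xi>, map_option N \<circ> g) \<in> H"
    and ran_dm: "(\<xi>, g) \<in> G \<Longrightarrow> ran g \<subseteq> dm J"
    and fired_full: "(TGD b hs, restr h (kv v (TGD b hs))) \<in> G \<Longrightarrow> avars hs \<subseteq> avars b \<Longrightarrow> inst h hs \<subseteq> J"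
begin

lemma finite_I: "finite I"
proof (rule finite_subset)
  show "I \<subseteq> (\<lambda>(R, ts). (R, map q ts)) ` J"
    using mem_I by force
qed (simp add: finite_J)

text \<open>If the trigger were logged, \<open>fired_full\<close> would put its head into
  \<open>J\<close>. A missing head atom therefore yields a genuine step in the logging variants as
  well as in the standard one.\<close>

lemma applicable_full:
  assumes "avars hs \<subseteq> avars b" "\<not> inst g hs \<subseteq> J"
  shows "applicable v J G (TGD b hs) g"
  using assms fired_full[of b hs g] active_full[of hs b J g] unfolding applicable_def by auto

lemma step_full:
  assumes "v \<noteq> CoreV" "TGD b hs \<in> \<Sigma>t" "avars hs \<subseteq> avars b" "\<not> inst g hs \<subseteq> J"
    and "is_trigger J (TGD b hs) g"
  shows "step v \<Sigma>t (Inst J, G) (Inst (J \<union> inst g hs), log_trigger v G (TGD b hs) g)"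
  unfolding step_non_core[OF assms(1)]
  using assms applicable_full fire_full by blast

lemma is_trigger_ran:
  assumes "is_trigger J \<xi> g"
  shows "ran (restr g (kv v \<xi>)) \<subseteq> dm J"
proof -
  have "g w \<in> adom J" if "w \<in> kv v \<xi>" for w
    using that assms kv_subset_bvars avars_in_adom unfolding is_trigger_def bvars_def by blast
  then show ?thesis
    by (auto simp: ran_def restr_def dm_def split: if_splits)
qed

text \<open>Shared by congruence steps, which leave the history of the \<Sigma>-chase alone, and by
  egd steps, which may log a trigger there; this is why \<open>H'\<close> may be larger than
  \<open>H\<close>.\<close>

lemma log_full:
  assumes "TGD b hs \<notin> \<Sigma>" "avars hs \<subseteq> avars b" "is_trigger J (TGD b hs) g" "H \<subseteq> H'"
    and J': "J' = J \<union> inst g hs" and G': "G' = log_trigger v G (TGD b hs) g"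
  shows "\<xi> \<in> \<Sigma> \<Longrightarrow> is_tgd \<xi> \<Longrightarrow> (\<xi>, f) \<in> G' \<Longrightarrow> (\<xi>, map_option N \<circ> f) \<in> H'"
    and "(\<xi>, f) \<in> G' \<Longrightarrow> ran f \<subseteq> dm J'"
    and "(TGD b' hs', restr h (kv v (TGD b' hs'))) \<in> G' \<Longrightarrow> avars hs' \<subseteq> avars b' \<Longrightarrow> inst h hs' \<subseteq> J'"
proof -
  show "\<xi> \<in> \<Sigma> \<Longrightarrow> is_tgd \<xi> \<Longrightarrow> (\<xi>, f) \<in> G' \<Longrightarrow> (\<xi>, map_option N \<circ> f) \<in> H'"
    using assms(1,4) hist unfolding G' log_trigger_def by (auto split: if_splits)
  have "dm J \<subseteq> dm J'"
    by (auto simp: dm_def J' adom_Un)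
  then show "(\<xi>, f) \<in> G' \<Longrightarrow> ran f \<subseteq> dm J'"
    using is_trigger_ran[OF assms(3)] ran_dm unfolding G' log_trigger_def by (fastforce split: if_splits)
  assume *: "(TGD b' hs', restr h (kv v (TGD b' hs'))) \<in> G'" "avars hs' \<subseteq> avars b'"
  show "inst h hs' \<subseteq> J'"
  proof (cases "(TGD b' hs', restr h (kv v (TGD b' hs'))) \<in> G")
    case True
    then show ?thesis using fired_full *(2) J' by blast
  next
    case False
    then have eq: "b' = b" "hs' = hs" "restr h (kv v (TGD b hs)) = restr g (kv v (TGD b hs))"
      using * unfolding G' log_trigger_def by (auto split: if_splits)
    have "inst h hs = inst g hs"
      using eq(3) kv_full[OF assms(2), of v] unfolding restr_eq_iff by (intro inst_cong) auto
    then show ?thesis using eq J' by blast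
  qed
qed

text \<open>The added atom exchanges one term for another with the same \<open>q\<close>-value, so
  it has the same image in \<open>I\<close> as the atom it comes from. Only the translated chase
  advances.\<close>

lemma saturate:
  assumes v: "v \<noteq> CoreV" and unsat: "\<not> saturated E ar (rels_of \<Sigma>) J"
  shows "\<exists>J' G'. step v \<Sigma>t (Inst J, G) (Inst J', G') \<and> simulation \<Sigma> ar E v J' G' I H q N"
proof -
  obtain R us i t where R: "R \<in> rels_of \<Sigma>" "(R, us) \<in> J" "length us = ar R" "i < ar R"
      "(us ! i, t) \<in> Erel E J" "(R, us[i := t]) \<notin> J"
    using unsat by (auto simp: saturated_def)
  obtain b hs where bh: "(repl_rule E R (ar R) i :: ('r,'c) dep) = TGD b hs"
    by (simp add: repl_rule_def)
  obtain h where h: "inst h b = {(E, [us ! i, t]), (R, us)}" "inst h hs = {(R, us[i := t])}"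
    using repl_trigger[of us "ar R" i R t] R bh by auto
  have full: "avars hs \<subseteq> avars b"
    using repl_rule_full bh by blast
  have tr: "is_trigger J (TGD b hs) h"
    using h R by (auto simp: is_trigger_def Erel_def)
  have "TGD b hs \<notin> \<Sigma>"
    using repl_rule_notin bh by metis
  note log = log_full[OF this full tr order.refl refl refl]
  define J' where "J' = J \<union> inst h hs"
  have J': "J' = insert (R, us[i := t]) J"
    using h by (simp add: J'_def)
  have RE: "R \<noteq> E" using R(1) E_new by auto
  have "t \<in> adom J"
    using R(5) by (force simp: Erel_def intro: adomI)
  then have "adom J' = adom J"
    using R(2) set_update_subset_insert[of us i t] unfolding J' by (force simp: adom_def)
  then have dm: "dm J' = dm J" by (simp add: dm_def)
  have Er: "Erel E J' = Erel E J"
    using RE by (auto simp: Erel_def J')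
  have "q t = q (us ! i)"
    using R(5) E_q by (auto simp: Erel_def)
  then have mapq: "map q (us[i := t]) = map q us"
    using R(3,4) by (simp add: map_update list_update_same_conv)
  have "simulation \<Sigma> ar E v J' (log_trigger v G (TGD b hs) h) I H q N"
  proof
    show "finite J'" using finite_J J' by simp
    show "(S, ws) \<in> I \<longleftrightarrow> S \<noteq> E \<and> (\<exists>us. (S, us) \<in> J' \<and> ws = map q us)" for S ws
      using mem_I mapq R(2) unfolding J' by (metis insert_iff prod.inject)
    show "(E, [s, t]) \<in> J' \<Longrightarrow> q s = q t" for s t
      using E_q RE by (auto simp: J')
  qed (use q_Cst N_Cst conn q_dm rep dm Er log in \<open>auto simp: J'_def\<close>)
  moreover have "step v \<Sigma>t (Inst J, G) (Inst J', log_trigger v G (TGD b hs) h)"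
    unfolding J'_def using step_full[OF v _ full _ tr] sigma_tgd_repl[OF R(1,4)] bh h R(6) by auto
  ultimately show ?thesis by blast
qed

lemma lift:
  assumes sat: "saturated E ar (rels_of \<Sigma>) J" and \<xi>: "\<xi> \<in> \<Sigma>" and h: "is_trigger I \<xi> h"
  obtains g where "is_trigger J \<xi> g" "\<And>w. w \<in> bvars \<xi> \<Longrightarrow> g w \<in> dm J \<and> q (g w) = h w \<and> N (g w) = h w"
proof -
  have "\<forall>w\<in>bvars \<xi>. \<exists>s. s \<in> dm J \<and> q s = h w \<and> N s = h w"
  proof
    fix w assume "w \<in> bvars \<xi>"
    then have "h w \<in> dm I"
      using h avars_in_adom[of w "body \<xi>" h I] by (auto simp: is_trigger_def bvars_def dm_def)
    then show "\<exists>s. s \<in> dm J \<and> q s = h w \<and> N s = h w"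
      using rep by blast
  qed
  then obtain g where g: "\<And>w. w \<in> bvars \<xi> \<Longrightarrow> g w \<in> dm J \<and> q (g w) = h w \<and> N (g w) = h w"
    by metis
  have "is_trigger J \<xi> g"
    using lift_trigger[OF sat \<xi> wf[OF \<xi>] q_Cst conn _ h] mem_I g by blast
  then show thesis using that g by blast
qed

lemma simulate_egd:
  assumes v: "v \<noteq> CoreV" and sat: "saturated E ar (rels_of \<Sigma>) J"
    and \<xi>: "EGD b x y \<in> \<Sigma>" and h: "is_trigger I (EGD b x y) h"
    and n: "{Nul n, w} = {h x, h y}" "w \<noteq> Nul n" and H': "H \<subseteq> H'"
  shows "\<exists>J' G' q'. step v \<Sigma>t (Inst J, G) (Inst J', G') \<and>
    simulation \<Sigma> ar E v J' G' (replace (Nul n) w I) H' q' N"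
proof -
  define hs :: "('r,'c) ratom list" where "hs = [(E, [RVar x, RVar y]), (E, [RVar y, RVar x])]"
  have xy: "x \<in> avars b" "y \<in> avars b"
    using egd_vars[OF \<xi>] by auto
  obtain g where g: "is_trigger J (EGD b x y) g"
      "\<And>w. w \<in> avars b \<Longrightarrow> g w \<in> dm J \<and> q (g w) = h w \<and> N (g w) = h w"
    using lift[OF sat \<xi> h] by (auto simp: bvars_def)
  have tr: "is_trigger J (TGD b hs) g"
    using g(1) by (simp add: is_trigger_def)
  have full: "avars hs \<subseteq> avars b"
    using xy by (auto simp: hs_def avars_def)
  have inst: "inst g hs = {(E, [g x, g y]), (E, [g y, g x])}"
    by (simp add: hs_def inst_def)
  have "h x \<noteq> h y" using n by auto
  \<comment> \<open>Edges of \<open>E\<close> in \<open>J\<close> join only terms with equal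
    \<open>q\<close>-value, so the edge between \<open>g x\<close> and \<open>g y\<close> is still
    missing.\<close>
  then have "q (g x) \<noteq> q (g y)"
    using g(2) xy by simp
  then have "\<not> inst g hs \<subseteq> J"
    using E_q inst by auto
  note st = step_full[OF v sigma_tgd_egd[OF \<xi>, folded hs_def] full this tr]
  note log = log_full[OF egd_tgd_notin[of b x y, folded hs_def] full tr H' refl refl]
  define J' where "J' = J \<union> inst g hs"
  define G' where "G' = log_trigger v G (TGD b hs) g"
  \<comment> \<open>The substitution performed by the egd. It is composed with \<open>q\<close>,
    while \<open>N\<close> keeps the old names.\<close>
  define \<rho> where "\<rho> u = (if u = Nul n then w else u)" for u
  define I' where "I' = replace (Nul n) w I"
  have I': "(R, us) \<in> I' \<longleftrightarrow> (\<exists>ts. (R, ts) \<in> I \<and> us = map \<rho> ts)" for R us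
    by (force simp: I'_def replace_def \<rho>_def)
  have gJ: "g x \<in> adom J" "g y \<in> adom J"
    using avars_in_adom xy tr unfolding is_trigger_def by (metis body.simps(1))+
  then have "adom J' = adom J"
    by (auto simp: J'_def adom_Un inst) (auto simp: adom_def)
  then have dm: "dm J' = dm J" by (simp add: dm_def)
  have adomI': "adom I' = \<rho> ` adom I"
  proof
    show "adom I' \<subseteq> \<rho> ` adom I"
    proof
      fix u assume "u \<in> adom I'"
      then obtain R us where "(R, us) \<in> I'" "u \<in> set us" by (rule adomE)
      then obtain ts t where "(R, ts) \<in> I" "t \<in> set ts" "u = \<rho> t"
        by (auto simp: I')
      then show "u \<in> \<rho> ` adom I"
        using adomI by fast
    qed
    show "\<rho> ` adom I \<subseteq> adom I'"
    proof
      fix u assume "u \<in> \<rho> ` adom I"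
      then obtain R ts t where "(R, ts) \<in> I" "t \<in> set ts" "u = \<rho> t"
        by (auto elim!: adomE)
      then show "u \<in> adom I'"
        using I'[of R "map \<rho> ts"] by (intro adomI[of R "map \<rho> ts"]) auto
    qed
  qed
  have "\<rho> ` range Cst = range Cst"
    by (auto simp: \<rho>_def image_image)
  then have dmI': "dm I' = \<rho> ` dm I"
    by (simp add: dm_def adomI' image_Un)
  have Er: "Erel E J \<subseteq> Erel E J'" and gE: "(g x, g y) \<in> Erel E J'" "(g y, g x) \<in> Erel E J'"
    by (auto simp: Erel_def J'_def inst)
  have mono: "(Erel E J)\<^sup>* \<subseteq> (Erel E J')\<^sup>*"
    using Er by (rule rtrancl_mono)
  have hI: "h x \<in> dm I" "h y \<in> dm I"
    using q_dm g(2) xy by metis+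
  have "simulation \<Sigma> ar E v J' G' I' H' (\<rho> \<circ> q) N"
  proof
    show "finite J'" using finite_J by (simp add: J'_def finite_inst)
    show "(\<rho> \<circ> q) (Cst c) = Cst c" for c
      by (simp add: \<rho>_def q_Cst)
    show "(S, ws) \<in> I' \<longleftrightarrow> S \<noteq> E \<and> (\<exists>us. (S, us) \<in> J' \<and> ws = map (\<rho> \<circ> q) us)" for S ws
    proof -
      have "S \<noteq> E \<Longrightarrow> (S, us) \<in> J' \<longleftrightarrow> (S, us) \<in> J" for us
        by (auto simp: J'_def inst)
      then show ?thesis
        unfolding I' mem_I by (metis map_map)
    qed
    show "(\<rho> \<circ> q) s = (\<rho> \<circ> q) t" if "(E, [s, t]) \<in> J'" for s t
    proof (cases "(E, [s, t]) \<in> J")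
      case True
      then show ?thesis using E_q by auto
    next
      case False
      then have "{q s, q t} = {h x, h y}"
        using that g(2) xy by (auto simp: J'_def inst)
      then show ?thesis
        using n by (auto simp: \<rho>_def doubleton_eq_iff)
    qed
    show "(s, t) \<in> (Erel E J')\<^sup>*" if "s \<in> dm J'" "t \<in> dm J'" "(\<rho> \<circ> q) s = (\<rho> \<circ> q) t" for s t
    proof (cases "q s = q t")
      case True
      then show ?thesis using conn that dm mono by blast
    next
      case False
      \<comment> \<open>The only new coincidences are between the fibres over \<open>h x\<close> and
        \<open>h y\<close>; the new edge bridges them.\<close>
      then have "{q s, q t} = {h x, h y}"
        using that(3) n by (auto simp: \<rho>_def split: if_splits)
      then consider "q s = q (g x)" "q t = q (g y)" | "q s = q (g y)" "q t = q (g x)"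
        using g(2) xy by (auto simp: doubleton_eq_iff)
      then show ?thesis
      proof cases
        case 1
        then have "(s, g x) \<in> (Erel E J')\<^sup>*" "(g y, t) \<in> (Erel E J')\<^sup>*"
          using conn that dm mono g(2) xy by (metis subsetD)+
        then show ?thesis using gE by (meson rtrancl.rtrancl_into_rtrancl rtrancl_trans)
      next
        case 2
        then have "(s, g y) \<in> (Erel E J')\<^sup>*" "(g x, t) \<in> (Erel E J')\<^sup>*"
          using conn that dm mono g(2) xy by (metis subsetD)+
        then show ?thesis using gE by (meson rtrancl.rtrancl_into_rtrancl rtrancl_trans)
      qed
    qed
    show "(\<rho> \<circ> q) s \<in> dm I'" if "s \<in> dm J'" for s
      using q_dm[of s] that dm dmI' by auto
    show "\<exists>s\<in>dm J'. (\<rho> \<circ> q) s = a \<and> N s = a" if "a \<in> dm I'" for a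
    proof -
      \<comment> \<open>The values left after the merge are old values other than
        \<open>Nul n\<close>. They are fixed by \<open>\<rho>\<close>, so their old representatives
        still serve.\<close>
      have "w \<in> dm I" using n(1) hI by (metis insertCI insertE singletonD)
      then have "a \<in> dm I" "a \<noteq> Nul n"
        using that adomI' n(2) by (auto simp: dm_def \<rho>_def split: if_splits)
      then obtain s where "s \<in> dm J" "q s = a" "N s = a"
        using rep by blast
      then show ?thesis
        using \<open>a \<noteq> Nul n\<close> dm by (auto simp: \<rho>_def)
    qed
  qed (use N_Cst log in \<open>auto simp: J'_def G'_def\<close>)
  then show ?thesis
    using st unfolding J'_def G'_def I'_def by blast
qed

lemma simulate_tgd:
  assumes v: "v \<noteq> CoreV" and sat: "saturated E ar (rels_of \<Sigma>) J"
    and \<xi>: "TGD b hs \<in> \<Sigma>" and h: "is_trigger I (TGD b hs) h"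
    and app: "applicable v I H (TGD b hs) h" and h': "fresh_ext I (TGD b hs) h h'"
  shows "\<exists>J' G' q' N'. step v \<Sigma>t (Inst J, G) (Inst J', G') \<and>
    simulation \<Sigma> ar E v J' G' (I \<union> inst h' hs) (log_trigger v H (TGD b hs) h) q' N'"
proof -
  let ?\<xi> = "TGD b hs"
  obtain g where g: "is_trigger J ?\<xi> g"
      "\<And>w. w \<in> avars b \<Longrightarrow> g w \<in> dm J \<and> q (g w) = h w \<and> N (g w) = h w"
    using lift[OF sat \<xi> h] by (auto simp: bvars_def)
  have hsE: "(R, ts) \<in> set hs \<Longrightarrow> R \<noteq> E" for R ts
    using rel_not_E[OF \<xi>] by auto
  have instE: "(R, us) \<in> inst f hs \<Longrightarrow> R \<noteq> E" for R us f
    using hsE by (auto elim!: inst_memE)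
  have key: "map_option N \<circ> restr g (kv v ?\<xi>) = restr h (kv v ?\<xi>)"
    using g(2) kv_subset_bvars[of v ?\<xi>] by (auto simp: restr_def fun_eq_iff bvars_def)
  have app': "applicable v J G ?\<xi> g"
  proof (cases "v = Std")
    case True
    \<comment> \<open>A witness in \<open>J\<close> for the lifted trigger would project along
      \<open>q\<close> to a witness in \<open>I\<close>, where the trigger is active.\<close>
    have "\<not> inst f hs \<subseteq> J" if f: "\<forall>w\<in>avars b. f w = g w" for f
    proof
      assume fJ: "inst f hs \<subseteq> J"
      have "inst (q \<circ> f) hs \<subseteq> I"
        unfolding inst_subset_iff
      proof (intro allI impI)
        fix R ts assume ts: "(R, ts) \<in> set hs"
        have "(R, map (inst_t f) ts) \<in> J"
          using fJ ts by (simp add: inst_subset_iff)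
        then show "(R, map (inst_t (q \<circ> f)) ts) \<in> I"
          using inst_comp_atom[of q hs "q \<circ> f" f R ts] q_Cst ts hsE[OF ts] mem_I by (metis comp_apply)
      qed
      moreover have "\<forall>w\<in>avars b. (q \<circ> f) w = h w"
        using f g(2) by simp
      ultimately show False
        using app True unfolding applicable_def by (metis active.simps(1))
    qed
    then show ?thesis using True by (auto simp: applicable_def)
  next
    case False
    then show ?thesis
      using hist[OF \<xi>, of "restr g (kv v ?\<xi>)"] key app by (auto simp: applicable_def)
  qed
  \<comment> \<open>The nulls chosen by \<open>h'\<close> are fresh for \<open>I\<close> but may
    still occur in \<open>J\<close>, where merged nulls survive. The translated chase therefore uses
    its own nulls \<open>Nul (B + w)\<close>, beyond all those of \<open>J\<close>.\<close>
  obtain B where B: "\<And>m. m \<in> nulls_of J \<Longrightarrow> m < B"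
    using finite_nulls_of[OF finite_J] finite_nat_set_iff_bounded by auto
  define X where "X = evars ?\<xi>"
  have X: "X = avars hs - avars b"
    by (simp add: X_def evars_def)
  define g' where "g' w = (if w \<in> avars b then g w else Nul (B + w))" for w
  define new where "new t \<longleftrightarrow> (\<exists>w\<in>X. t = Nul (B + w))" for t :: "'c trm"
  \<comment> \<open>Extends \<open>q\<close> and \<open>N\<close> alike: subtracting
    \<open>B\<close> recovers the existential variable, whose value is then given by
    \<open>h'\<close>. The value 0 for constants is a dummy, since no constant is new.\<close>
  define up where "up f t = (if new t then h' (case t of Nul m \<Rightarrow> m - B | _ \<Rightarrow> 0) else f t)"
    for f :: "'c trm \<Rightarrow> 'c trm" and t
  have h'b: "h' w = h w" if "w \<in> avars b" for w
    using h' that by (auto simp: fresh_ext_def bvars_def)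
  have h'inj: "inj_on h' X"
    using h' by (auto simp: fresh_ext_def X_def)
  have h'new: "\<exists>n. h' w = Nul n \<and> n \<notin> nulls_of I" if "w \<in> X" for w
    using h' that by (auto simp: fresh_ext_def X_def)
  have up_old: "up f t = f t" if "t \<in> dm J" for f t
  proof -
    have "\<not> new t"
      using that B by (fastforce simp: new_def Nul_in_dm_iff)
    then show ?thesis by (simp add: up_def)
  qed
  have up_new: "up f (Nul (B + w)) = h' w" if "w \<in> X" for f w
    using that by (auto simp: up_def new_def)
  have up_g': "up f (g' w) = h' w" if "w \<in> avars hs" "\<And>w. w \<in> avars b \<Longrightarrow> f (g w) = h w" for f w
    using that g(2) h'b up_old up_new by (auto simp: g'_def X)
  define J' where "J' = J \<union> inst g' hs"
  define G' where "G' = log_trigger v G ?\<xi> g"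
  define I' where "I' = I \<union> inst h' hs"
  define H' where "H' = log_trigger v H ?\<xi> h"
  have fr: "fresh_ext J ?\<xi> g g'"
    unfolding fresh_ext_def X_def[symmetric]
  proof (intro conjI ballI)
    show "inj_on g' X" by (auto simp: inj_on_def g'_def X)
    fix w assume "w \<in> X"
    then show "\<exists>n. g' w = Nul n \<and> n \<notin> nulls_of J"
      using B by (force simp: g'_def X)
  qed (simp add: g'_def bvars_def)
  have st: "step v \<Sigma>t (Inst J, G) (Inst J', G')"
    unfolding step_non_core[OF v]
  proof (intro bexI[of _ ?\<xi>] exI[of _ g] conjI)
    show "fire J ?\<xi> g (Inst J')"
      using fr by (auto simp: J'_def)
  qed (use g app' sigma_tgd_tgd[OF \<xi>] in \<open>auto simp: G'_def\<close>)
  have dmJ: "dm J \<subseteq> dm J'"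
    by (auto simp: dm_def J'_def adom_Un)
  have dmI: "dm I \<subseteq> dm I'"
    by (auto simp: dm_def I'_def adom_Un)
  have g'J: "g' w \<in> adom J'" if "w \<in> avars hs" for w
    using avars_in_adom[OF that, of g' J'] by (simp add: J'_def)
  have h'I: "h' w \<in> adom I'" if "w \<in> avars hs" for w
    using avars_in_adom[OF that, of h' I'] by (simp add: I'_def)
  have dmJ_cases: "s \<in> dm J \<or> (\<exists>w\<in>X. s = Nul (B + w))" if "s \<in> dm J'" for s
  proof -
    have "adom J' \<subseteq> adom J \<union> (range Cst \<union> g' ` avars hs)"
      using adom_inst[of g' hs] by (auto simp: J'_def adom_Un)
    then have "s \<in> dm J \<or> s \<in> g' ` avars hs"
      using that by (auto simp: dm_def)
    then show ?thesis
      using g(2) by (auto simp: g'_def X split: if_splits)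
  qed
  have upq_Cst: "up q (Cst c) = Cst c" for c
    by (simp add: up_old q_Cst)
  have Er: "Erel E J' = Erel E J"
    using instE by (auto simp: Erel_def J'_def)
  have old_map: "map (up q) ws = map q ws" if "(R, ws) \<in> J" for R ws
    using that by (auto intro!: up_old simp: dm_def intro: adomI)
  have inst_map: "map (up q) (map (inst_t g') ts) = map (inst_t h') ts" if "(R, ts) \<in> set hs" for R ts
    using inst_comp_atom[of "up q" hs h' g' R ts] upq_Cst up_g'[of _ q] that g(2) by metis
  have fresh_q: "q t \<noteq> h' w" if "t \<in> dm J" "w \<in> X" for t w
    using q_dm[OF that(1)] h'new[OF that(2)] by (auto simp: Nul_in_dm_iff)
  have "simulation \<Sigma> ar E v J' G' I' H' (up q) (up N)"
  proof
    show "finite J'" using finite_J by (simp add: J'_def finite_inst)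
    show "up q (Cst c) = Cst c" for c by (rule upq_Cst)
    show "up N (Cst c) = Cst c" for c by (simp add: up_old N_Cst)
    show "(R, us) \<in> I' \<longleftrightarrow> R \<noteq> E \<and> (\<exists>ws. (R, ws) \<in> J' \<and> us = map (up q) ws)" for R us
    proof
      assume "(R, us) \<in> I'"
      then consider "(R, us) \<in> I" | ts where "(R, ts) \<in> set hs" "us = map (inst_t h') ts"
        by (auto simp: I'_def elim!: inst_memE)
      then show "R \<noteq> E \<and> (\<exists>ws. (R, ws) \<in> J' \<and> us = map (up q) ws)"
      proof cases
        case 1
        then obtain ws where "R \<noteq> E" "(R, ws) \<in> J" "us = map q ws"
          using mem_I by blast
        then show ?thesis
          using old_map[of R ws] by (auto simp: J'_def)
      next
        case 2
        then show ?thesis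
          using hsE inst_map[OF 2(1)] inst_memI[OF 2(1), of g'] by (metis J'_def UnI2)
      qed
    next
      assume "R \<noteq> E \<and> (\<exists>ws. (R, ws) \<in> J' \<and> us = map (up q) ws)"
      then obtain ws where ws: "R \<noteq> E" "(R, ws) \<in> J'" "us = map (up q) ws" by blast
      then consider "(R, ws) \<in> J" | ts where "(R, ts) \<in> set hs" "ws = map (inst_t g') ts"
        by (auto simp: J'_def elim!: inst_memE)
      then show "(R, us) \<in> I'"
      proof cases
        case 1
        then show ?thesis
          using ws old_map[OF 1] mem_I I'_def by auto
      next
        case 2
        then show ?thesis
          using ws inst_map[OF 2(1)] inst_memI[OF 2(1), of h'] by (metis I'_def UnI2)
      qed
    qed
    show "up q s = up q t" if "(E, [s, t]) \<in> J'" for s t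
    proof -
      have *: "(E, [s, t]) \<in> J"
        using that instE by (auto simp: J'_def)
      then show ?thesis
        using old_map[OF *] E_q[OF *] by simp
    qed
    show "(s, t) \<in> (Erel E J')\<^sup>*" if st: "s \<in> dm J'" "t \<in> dm J'" "up q s = up q t" for s t
    proof -
      \<comment> \<open>A new null shares its value with no other term: \<open>h'\<close> avoids the
        nulls of \<open>I\<close> and is injective on the existential variables.\<close>
      have "(s \<in> dm J \<and> t \<in> dm J) \<or> s = t"
        using dmJ_cases[OF st(1)] dmJ_cases[OF st(2)] st(3) fresh_q inj_onD[OF h'inj]
        by (metis up_new up_old)
      then show ?thesis
        using conn[of s t] st(3) Er by (auto simp: up_old)
    qed
    show "up q s \<in> dm I'" if "s \<in> dm J'" for s
      using dmJ_cases[OF that]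
    proof
      assume "s \<in> dm J"
      then show ?thesis using q_dm dmI by (auto simp: up_old)
    next
      assume "\<exists>w\<in>X. s = Nul (B + w)"
      then show ?thesis using up_new h'I by (auto simp: dm_def X)
    qed
    show "\<exists>s\<in>dm J'. up q s = a \<and> up N s = a" if "a \<in> dm I'" for a
    proof (cases "a \<in> dm I")
      case True
      then show ?thesis
        using rep dmJ up_old by (metis subsetD)
    next
      case False
      then have "a \<in> adom (inst h' hs)"
        using that by (auto simp: dm_def I'_def adom_Un)
      then obtain w where "w \<in> avars hs" "a = h' w"
        using adom_inst[of h' hs] False by auto
      then show ?thesis
        using g'J up_g' g(2) by (auto simp: dm_def intro!: bexI[of _ "g' w"])
    qed
    show "(\<xi>, map_option (up N) \<circ> f) \<in> H'" if *: "\<xi> \<in> \<Sigma>" "is_tgd \<xi>" "(\<xi>, f) \<in> G'" for \<xi> f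
    proof -
      have "ran f \<subseteq> dm J"
        using *(3) ran_dm is_trigger_ran[OF g(1)] unfolding G'_def log_trigger_def
        by (auto split: if_splits)
      \<comment> \<open>Recorded keys range over old terms, on which extending \<open>N\<close>
        changes nothing; this is the purpose of the invariant \<open>ran_dm\<close>.\<close>
      then have "map_option (up N) \<circ> f = map_option N \<circ> f"
        by (auto simp: fun_eq_iff ran_def subset_iff up_old intro!: option.map_cong)
      then show ?thesis
        using hist[OF *(1,2)] *(3) key unfolding G'_def H'_def log_trigger_def
        by (auto split: if_splits)
    qed
    show "ran f \<subseteq> dm J'" if "(\<xi>, f) \<in> G'" for \<xi> f
      using that ran_dm is_trigger_ran[OF g(1)] dmJ unfolding G'_def log_trigger_def
      by (fastforce split: if_splits)
    show "inst k hs' \<subseteq> J'" if *: "(TGD b' hs', restr k (kv v (TGD b' hs'))) \<in> G'" "avars hs' \<subseteq> avars b'"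
      for b' hs' k
    proof (cases "(TGD b' hs', restr k (kv v (TGD b' hs'))) \<in> G")
      case True
      then show ?thesis using fired_full *(2) J'_def by blast
    next
      case False
      then have eq: "b' = b" "hs' = hs" "restr k (kv v ?\<xi>) = restr g (kv v ?\<xi>)"
        using * unfolding G'_def log_trigger_def by (auto split: if_splits)
      have "inst k hs = inst g' hs"
        using eq kv_full[of hs b v] *(2) unfolding restr_eq_iff
        by (intro inst_cong) (auto simp: g'_def)
      then show ?thesis using eq J'_def by blast
    qed
  qed
  then show ?thesis
    using st unfolding I'_def H'_def by blast
qed

end

context dependencies
begin

text \<open>Two nested inductions. Every mirrored step, and every congruence step, descends in the
  outer induction on the translated chase. The inner one covers histories that grow while
  \<open>I\<close> and \<open>J\<close> stay fixed.\<close>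

lemma simulation_accp:
  assumes v: "v \<noteq> CoreV"
    and "Wellfounded.accp (\<lambda>y x. step v \<Sigma>t x y) c" "c = (Inst J, G)" "simulation \<Sigma> ar E v J G I H q N"
  shows "Wellfounded.accp (\<lambda>y x. step v \<Sigma> x y) (Inst I, H)"
  using assms(2-)
proof (induction arbitrary: J G I H q N rule: accp.induct)
  fix c J G I H q N
  assume IH: "\<And>y J G I H q N. step v \<Sigma>t c y \<Longrightarrow> y = (Inst J, G) \<Longrightarrow> simulation \<Sigma> ar E v J G I H q N
      \<Longrightarrow> Wellfounded.accp (\<lambda>y x. step v \<Sigma> x y) (Inst I, H)"
    and c: "c = (Inst J, G)" and "simulation \<Sigma> ar E v J G I H q N"
  then interpret S: simulation \<Sigma> ar E v J G I H q N by simp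
  show "Wellfounded.accp (\<lambda>y x. step v \<Sigma> x y) (Inst I, H)"
  proof (cases "saturated E ar (rels_of \<Sigma>) J")
    case False
    then show ?thesis
      using S.saturate[OF v] IH c by blast
  next
    case sat: True
    define T where "T = {(\<xi>, restr h (kv v \<xi>)) | \<xi> h. \<xi> \<in> \<Sigma> \<and> is_trigger I \<xi> h}"
    have finT: "finite T"
      unfolding T_def by (rule finite_trigger_keys[OF finite_\<Sigma> S.finite_I kv_subset_bvars])
    have "Wellfounded.accp (\<lambda>y x. step v \<Sigma> x y) (Inst I, H')" if "simulation \<Sigma> ar E v J G I H' q N" for H'
      using that
    proof (induction "card (T - H')" arbitrary: H' rule: less_induct)
      case less
      interpret S': simulation \<Sigma> ar E v J G I H' q N by (rule less.prems)
      show ?case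
      proof (rule accpI)
        fix y assume "step v \<Sigma> (Inst I, H') y"
        moreover obtain S'' H'' where y: "y = (S'', H'')" by (cases y)
        ultimately obtain \<xi> h where \<xi>: "\<xi> \<in> \<Sigma>" and h: "is_trigger I \<xi> h" and app: "applicable v I H' \<xi> h"
          and fire: "fire I \<xi> h S''" and H'': "H'' = log_trigger v H' \<xi> h"
          using step_non_core[OF v] by blast
        show "Wellfounded.accp (\<lambda>y x. step v \<Sigma> x y) y"
        proof (cases \<xi>)
          case (TGD b hs)
          then obtain h' where h': "fresh_ext I (TGD b hs) h h'" "S'' = Inst (I \<union> inst h' hs)"
            using fire by auto
          show ?thesis
            using S'.simulate_tgd[OF v sat, of b hs h h'] \<xi> h app h' TGD IH c y H'' by blast
        next
          case (EGD b x z)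
          show ?thesis
          proof (cases "h x = h z")
            case True
            \<comment> \<open>A trivial egd step is not mirrored; it only consumes one of finitely many triggers.\<close>
            have S'': "S'' = Inst I"
              using fire EGD True by (simp add: egd_result_same)
            have vS: "v \<noteq> Std"
              using app EGD True by (auto simp: applicable_def)
            then have Hi: "H'' = insert (\<xi>, restr h (kv v \<xi>)) H'" "(\<xi>, restr h (kv v \<xi>)) \<notin> H'"
              using H'' app by (auto simp: log_trigger_def applicable_def)
            have "(\<xi>, restr h (kv v \<xi>)) \<in> T"
              using \<xi> h by (auto simp: T_def)
            then have "T - H'' \<subset> T - H'"
              using Hi by auto
            then have "card (T - H'') < card (T - H')"
              using finT by (intro psubset_card_mono) auto
            moreover have "simulation \<Sigma> ar E v J G I H'' q N"
              using S'.hist Hi(1) S'.finite_J S'.q_Cst S'.N_Cst S'.mem_I S'.E_q S'.conn S'.q_dm S'.rep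
                S'.ran_dm S'.fired_full
              by unfold_locales auto
            ultimately show ?thesis
              using less.hyps y S'' by blast
          next
            case False
            have "H' \<subseteq> H''"
              by (auto simp: H'' log_trigger_def)
            note sim = S'.simulate_egd[OF v sat \<xi>[unfolded EGD] h[unfolded EGD] _ _ this]
            have S'': "S'' = egd_result I (h x) (h z)"
              using fire EGD by simp
            show ?thesis
            proof (cases rule: egd_result_cases[OF False, of I])
              case 1
              then show ?thesis
                using S'' y by (auto intro: accpI)
            next
              case (2 n w)
              then show ?thesis
                using sim[OF 2(2,3)] IH c y S'' by auto
            qed
          qed
        qed
      qed
    qed
    then show ?thesis
      using S.simulation_axioms by blast
  qed
qed

lemma terminates_non_core:
  assumes v: "v \<noteq> CoreV" and I: "finite I" "E \<notin> fst ` I" and T: "terminates v \<Sigma>t I"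
  shows "terminates v \<Sigma> I"
proof -
  have noE: "(E, us) \<notin> I" for us
    using I(2) by force
  have "simulation \<Sigma> ar E v I {} I {} id id"
    by unfold_locales (use I noE in auto)
  then show ?thesis
    using T simulation_accp[OF v] unfolding terminates_iff_accp by blast
qed

end

section \<open>Parallel firing and cores\<close>

definition act_keys :: "('r,'c) dep set \<Rightarrow> ('r,'c) atom set \<Rightarrow> (('r,'c) dep \<times> (nat \<Rightarrow> 'c trm option)) set" where
  "act_keys \<Sigma> I = {(\<xi>, restr h (bvars \<xi>)) | \<xi> h. \<xi> \<in> \<Sigma> \<and> is_tgd \<xi> \<and> is_trigger I \<xi> h \<and> active I \<xi> h}"

definition fires_all :: "('r,'c) dep set \<Rightarrow> ('r,'c) atom set \<Rightarrow>
    (('r,'c) dep \<times> (nat \<Rightarrow> 'c trm option) \<Rightarrow> nat \<Rightarrow> 'c trm) \<Rightarrow> bool" where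
  "fires_all \<Sigma> I ext \<longleftrightarrow>
     (\<forall>k\<in>act_keys \<Sigma> I. (\<forall>v\<in>bvars (fst k). snd k v = Some (ext k v)) \<and> fresh_ext I (fst k) (ext k) (ext k))
     \<and> (\<forall>k\<in>act_keys \<Sigma> I. \<forall>k'\<in>act_keys \<Sigma> I.
          k \<noteq> k' \<longrightarrow> ext k ` evars (fst k) \<inter> ext k' ` evars (fst k') = {})"

lemma parallel_iff:
  "parallel \<Sigma> I J \<longleftrightarrow>
    (\<exists>ext. fires_all \<Sigma> I ext \<and> J = I \<union> (\<Union>k\<in>act_keys \<Sigma> I. inst (ext k) (heads (fst k))))"
  unfolding parallel_def Let_def act_keys_def[symmetric] fires_all_def by (simp add: conj_assoc)

lemma finite_act_keys:
  assumes "finite \<Sigma>" "finite I"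
  shows "finite (act_keys \<Sigma> I)"
proof (rule finite_subset)
  show "act_keys \<Sigma> I \<subseteq> {(\<xi>, restr h (bvars \<xi>)) | \<xi> h. \<xi> \<in> \<Sigma> \<and> is_trigger I \<xi> h}"
    by (auto simp: act_keys_def)
  show "finite {(\<xi>, restr h (bvars \<xi>)) | \<xi> h. \<xi> \<in> \<Sigma> \<and> is_trigger I \<xi> h}"
    by (rule finite_trigger_keys[OF assms]) simp
qed

lemma parallel_finite: "finite \<Sigma> \<Longrightarrow> finite I \<Longrightarrow> parallel \<Sigma> I J \<Longrightarrow> finite J"
  unfolding parallel_iff by (auto intro: finite_act_keys finite_inst)

lemma parallel_superset: "parallel \<Sigma> I J \<Longrightarrow> I \<subseteq> J"
  unfolding parallel_iff by blast

text \<open>Ensures that the translated core chase can go on as long as a trigger is active;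
  otherwise an accessible configuration without successor might fail to be a model.\<close>

lemma parallel_exists:
  fixes \<Sigma> :: "('r,'c) dep set"
  assumes "finite \<Sigma>" "finite I"
  shows "\<exists>J. parallel \<Sigma> I J"
proof -
  let ?K = "act_keys \<Sigma> I"
  obtain idx :: "_ \<Rightarrow> nat" where idx: "inj_on idx ?K"
    using finite_imp_inj_to_nat_seg[OF finite_act_keys[OF assms]] by metis
  obtain B where B: "\<And>m. m \<in> nulls_of I \<Longrightarrow> m < B"
    using finite_nulls_of[OF assms(2)] finite_nat_set_iff_bounded by auto
  \<comment> \<open>Pairing the index of the trigger with the variable keeps the nulls of different
    triggers disjoint, and \<open>B\<close> keeps them away from \<open>I\<close>.\<close>
  define ext where "ext k v = (if v \<in> bvars (fst k) then the (snd k v) else Nul (B + prod_encode (idx k, v)))"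
    for k :: "('r,'c) dep \<times> (nat \<Rightarrow> 'c trm option)" and v
  have ext_e: "ext k v = Nul (B + prod_encode (idx k, v))" if "v \<in> evars (fst k)" for k v
    using that by (auto simp: ext_def evars_def bvars_def)
  have "fires_all \<Sigma> I ext"
    unfolding fires_all_def
  proof (intro conjI ballI impI)
    fix k v assume "k \<in> ?K" "v \<in> bvars (fst k)"
    then show "snd k v = Some (ext k v)"
      by (auto simp: act_keys_def ext_def restr_def)
  next
    fix k assume "k \<in> ?K"
    have "inj_on (ext k) (evars (fst k))"
      by (auto simp: inj_on_def ext_e)
    moreover have "\<exists>n. ext k v = Nul n \<and> n \<notin> nulls_of I" if "v \<in> evars (fst k)" for v
      using ext_e[OF that] B by force
    ultimately show "fresh_ext I (fst k) (ext k) (ext k)"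
      by (simp add: fresh_ext_def)
  next
    fix k k' assume "k \<in> ?K" "k' \<in> ?K" "k \<noteq> k'"
    then have "idx k \<noteq> idx k'"
      using idx by (auto dest: inj_onD)
    then show "ext k ` evars (fst k) \<inter> ext k' ` evars (fst k') = {}"
      by (auto simp: ext_e)
  qed
  then show ?thesis unfolding parallel_iff by blast
qed

lemma act_keysE:
  assumes "fires_all \<Sigma> I ext" "k \<in> act_keys \<Sigma> I"
  obtains "fst k \<in> \<Sigma>" "is_tgd (fst k)" "is_trigger I (fst k) (ext k)"
proof -
  obtain \<xi> h where k: "k = (\<xi>, restr h (bvars \<xi>))" "\<xi> \<in> \<Sigma>" "is_tgd \<xi>" "is_trigger I \<xi> h"
    using assms(2) by (auto simp: act_keys_def)
  have eq: "\<forall>v\<in>bvars \<xi>. restr h (bvars \<xi>) v = Some (ext k v)"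
    using assms k(1) by (auto simp: fires_all_def)
  have "inst (ext k) (body \<xi>) = inst h (body \<xi>)"
    using eq by (intro inst_cong) (auto simp: restr_def bvars_def)
  then show thesis using that k by (simp add: is_trigger_def)
qed

lemma avars_heads: "avars (heads \<xi>) \<subseteq> bvars \<xi> \<union> evars \<xi>"
  by (auto simp: bvars_def evars_def)

lemma parallel_satisfies:
  assumes P: "parallel \<Sigma> I J" and \<xi>: "\<xi> \<in> \<Sigma>" "is_tgd \<xi>" and h: "is_trigger I \<xi> h"
  shows "\<exists>h'. (\<forall>v\<in>bvars \<xi>. h' v = h v) \<and> inst h' (heads \<xi>) \<subseteq> J"
proof -
  obtain ext where ext: "fires_all \<Sigma> I ext" "J = I \<union> (\<Union>k\<in>act_keys \<Sigma> I. inst (ext k) (heads (fst k)))"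
    using P unfolding parallel_iff by blast
  obtain b hs where bh: "\<xi> = TGD b hs"
    using \<xi>(2) by (cases \<xi>) auto
  show ?thesis
  proof (cases "active I \<xi> h")
    case False
    then show ?thesis using bh ext(2) by (auto simp: bvars_def)
  next
    case True
    let ?k = "(\<xi>, restr h (bvars \<xi>))"
    have k: "?k \<in> act_keys \<Sigma> I"
      using True \<xi> h by (auto simp: act_keys_def)
    have "\<forall>v\<in>bvars \<xi>. restr h (bvars \<xi>) v = Some (ext ?k v)"
      using ext(1) k unfolding fires_all_def by fastforce
    then have "\<forall>v\<in>bvars \<xi>. ext ?k v = h v"
      by (auto simp: restr_def)
    moreover have "inst (ext ?k) (heads \<xi>) \<subseteq> J"
      using ext(2) k by force
    ultimately show ?thesis by blast
  qed
qed

text \<open>Fresh nulls can be sent to any witnesses available in the target. The witnesses may lie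
  in a larger \<open>M'\<close>, so the lemma applies both to a model, with \<open>M' = M\<close>,
  and to the result of one parallel step on the target.\<close>

lemma parallel_hom:
  assumes P: "parallel \<Sigma> I J" and g: "hom g I M" and M: "M \<subseteq> M'"
    and sat: "\<And>\<xi> h. \<xi> \<in> \<Sigma> \<Longrightarrow> is_tgd \<xi> \<Longrightarrow> is_trigger I \<xi> h \<Longrightarrow>
      \<exists>h'. (\<forall>v\<in>bvars \<xi>. h' v = g (h v)) \<and> inst h' (heads \<xi>) \<subseteq> M'"
  shows "\<exists>g'. hom g' J M'"
proof -
  let ?K = "act_keys \<Sigma> I"
  obtain ext where ext: "fires_all \<Sigma> I ext" and J: "J = I \<union> (\<Union>k\<in>?K. inst (ext k) (heads (fst k)))"
    using P unfolding parallel_iff by blast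
  have "\<forall>k\<in>?K. \<exists>W. (\<forall>v\<in>bvars (fst k). W v = g (ext k v)) \<and> inst W (heads (fst k)) \<subseteq> M'"
    using sat act_keysE[OF ext] by metis
  then obtain W where W: "\<And>k v. k \<in> ?K \<Longrightarrow> v \<in> bvars (fst k) \<Longrightarrow> W k v = g (ext k v)"
      "\<And>k. k \<in> ?K \<Longrightarrow> inst (W k) (heads (fst k)) \<subseteq> M'"
    by metis
  \<comment> \<open>Disjointness across triggers and injectivity within each trigger give every
    fresh null a unique owner, a trigger with an existential variable, so \<open>g'\<close> is well
    defined.\<close>
  define own where "own t kv \<longleftrightarrow> fst kv \<in> ?K \<and> snd kv \<in> evars (fst (fst kv)) \<and> ext (fst kv) (snd kv) = t" for t kv
  define g' where "g' t = (if Ex (own t) then (let kv = SOME kv. own t kv in W (fst kv) (snd kv)) else g t)" for t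
  have own_unique: "kv = kv'" if "own t kv" "own t kv'" for t kv kv'
  proof -
    have "fst kv = fst kv'"
    proof (rule ccontr)
      assume "fst kv \<noteq> fst kv'"
      then have "ext (fst kv) ` evars (fst (fst kv)) \<inter> ext (fst kv') ` evars (fst (fst kv')) = {}"
        using ext that unfolding fires_all_def own_def by blast
      then show False using that unfolding own_def by blast
    qed
    moreover have "inj_on (ext (fst kv)) (evars (fst (fst kv)))"
      using ext that unfolding fires_all_def own_def fresh_ext_def by blast
    ultimately show ?thesis
      using that unfolding own_def by (metis inj_onD prod.collapse)
  qed
  have g'_new: "g' (ext k v) = W k v" if "k \<in> ?K" "v \<in> evars (fst k)" for k v
  proof -
    have o: "own (ext k v) (k, v)" using that by (simp add: own_def)
    then have "(SOME kv. own (ext k v) kv) = (k, v)"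
      using own_unique by (metis someI)
    moreover have "Ex (own (ext k v))" using o by blast
    ultimately show ?thesis
      by (simp add: g'_def)
  qed
  have g'_old: "g' t = g t" if "t \<in> dm I" for t
  proof -
    have "\<not> own t kv" for kv
    proof
      assume o: "own t kv"
      then obtain n where "t = Nul n" "n \<notin> nulls_of I"
        using ext unfolding fires_all_def fresh_ext_def own_def by metis
      then show False using that by (simp add: Nul_in_dm_iff)
    qed
    then show ?thesis by (simp add: g'_def)
  qed
  have "hom g' J M'"
    unfolding hom_iff
  proof (intro conjI allI impI)
    show Cst: "g' (Cst c) = Cst c" for c
      using g'_old hom_Cst[OF g] by simp
    fix R ts assume "(R, ts) \<in> J"
    then consider "(R, ts) \<in> I" | k where "k \<in> ?K" "(R, ts) \<in> inst (ext k) (heads (fst k))"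
      using J by blast
    then show "(R, map g' ts) \<in> M'"
    proof cases
      case 1
      then have "map g' ts = map g ts"
        by (auto intro!: g'_old simp: dm_def intro: adomI)
      then show ?thesis using hom_atom[OF g 1] M by (metis subsetD)
    next
      case 2
      obtain us where us: "(R, us) \<in> set (heads (fst k))" "ts = map (inst_t (ext k)) us"
        using 2(2) by (rule inst_memE)
      have "W k v = g' (ext k v)" if "v \<in> avars (heads (fst k))" for v
      proof (cases "v \<in> bvars (fst k)")
        case True
        have "is_trigger I (fst k) (ext k)"
          using act_keysE[OF ext 2(1)] by blast
        then have "ext k v \<in> dm I"
          using True avars_in_adom[of v "body (fst k)" "ext k" I] by (auto simp: is_trigger_def bvars_def dm_def)
        then show ?thesis using W(1)[OF 2(1) True] g'_old by simp
      next
        case False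
        then have "v \<in> evars (fst k)" using that avars_heads by blast
        then show ?thesis using g'_new[OF 2(1)] by simp
      qed
      then have "map (inst_t (W k)) us = map g' ts"
        using inst_comp_atom[of g' "heads (fst k)" "W k" "ext k" R us] Cst us by metis
      then show ?thesis
        using W(2)[OF 2(1)] us(1) by (metis inst_subset_iff)
    qed
  qed
  then show ?thesis by blast
qed

text \<open>Take a subset of \<open>J\<close> of least cardinality that receives a homomorphism from
  \<open>J\<close>; a further proper retreat would compose to a smaller one.\<close>

lemma core_exists:
  assumes "finite J"
  shows "\<exists>C. is_core_of J C"
proof -
  let ?P = "\<lambda>C. C \<subseteq> J \<and> (\<exists>f. hom f J C)"
  obtain C where C: "?P C" and min: "\<And>C'. ?P C' \<Longrightarrow> card C \<le> card C'"
    using ex_has_least_nat[of ?P J card] hom_id[of J J] by blast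
  have "\<not> (C' \<subset> C \<and> hom f C C')" for C' f
  proof
    assume *: "C' \<subset> C \<and> hom f C C'"
    obtain f' where f': "hom f' J C" using C by blast
    have "hom (f \<circ> f') J C'"
      using hom_comp[OF f'] * by blast
    then have "card C \<le> card C'"
      using min[of C'] C * by blast
    moreover have "card C' < card C"
      using * C assms by (meson finite_subset psubset_card_mono)
    ultimately show False by simp
  qed
  then show ?thesis using C unfolding is_core_of_def by blast
qed

lemma hom_funpow:
  assumes "hom e C C"
  shows "hom (e ^^ n) C C"
proof (induction n)
  case 0
  then show ?case using hom_id[of C C] by (simp add: id_def)
next
  case (Suc n)
  then show ?case using hom_comp[OF Suc assms] by (simp add: comp_def)
qed

text \<open>By minimality of the core the induced map on atoms is onto, hence a permutation of a
  finite set, hence of finite order. A power that fixes every atom fixes every term.\<close>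

lemma core_endomorphism_power:
  assumes core: "is_core_of J C" and fin: "finite C" and e: "hom e C C"
  shows "\<exists>m. \<forall>t\<in>adom C. (e ^^ Suc m) t = t"
proof -
  define F where "F = (\<lambda>(R, ts). (R :: 'a, map e ts))"
  have sub: "F ` C \<subseteq> C"
    using e by (simp add: hom_def F_def)
  have "hom e C (F ` C)"
    using e by (simp add: hom_def F_def)
  then have surj: "F ` C = C"
    using core sub unfolding is_core_of_def by blast
  then have inj: "inj_on F C"
    using fin by (simp add: eq_card_imp_inj_on)
  \<comment> \<open>Extended by the identity outside \<open>C\<close> so as to be a permutation of
    the whole type.\<close>
  define p where "p a = (if a \<in> C then F a else a)" for a
  have "bij_betw F C C" using surj inj by (simp add: bij_betw_def)
  then have "bij_betw p C C"
    by (rule bij_betw_cong[THEN iffD1, rotated]) (simp add: p_def)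
  then have "p permutes C"
    by (rule bij_imp_permutes) (simp add: p_def)
  then have "permutation p"
    using fin permutation_permutes by blast
  then obtain n where n: "p ^^ n = id" "n > 0"
    using permutation_is_nilpotent by blast
  have pow: "a \<in> C \<Longrightarrow> (p ^^ k) a = (\<lambda>(R, ts). (R, map (e ^^ k) ts)) a \<and> (p ^^ k) a \<in> C" for a k
  proof (induction k)
    case 0
    then show ?case by (cases a) auto
  next
    case (Suc k)
    then show ?case
      using sub by (cases a) (auto simp: p_def F_def)
  qed
  have "(e ^^ n) t = t" if t: "t \<in> adom C" for t
  proof -
    obtain R ts where ts: "(R, ts) \<in> C" "t \<in> set ts"
      using t by (rule adomE)
    then have "map (e ^^ n) ts = ts"
      using pow[OF ts(1), of n] n by simp
    then show ?thesis using ts(2) by (metis map_idI map_eq_conv list.map_ident)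
  qed
  then show ?thesis using n(2) by (metis Suc_pred')
qed

section \<open>Models\<close>

definition model :: "('r,'c) dep set \<Rightarrow> ('r,'c) atom set \<Rightarrow> bool" where
  "model \<Sigma> M \<longleftrightarrow> (\<forall>\<xi>\<in>\<Sigma>. \<forall>h. is_trigger M \<xi> h \<longrightarrow> \<not> active M \<xi> h)"

lemma model_tgd:
  assumes "model \<Sigma> M" "TGD b hs \<in> \<Sigma>" "is_trigger M (TGD b hs) h"
  obtains h' where "\<And>v. v \<in> avars b \<Longrightarrow> h' v = h v" "inst h' hs \<subseteq> M"
proof -
  have "\<not> active M (TGD b hs) h"
    using assms unfolding model_def by blast
  then show thesis using that by auto
qed

lemma model_egd: "model \<Sigma> M \<Longrightarrow> EGD b x y \<in> \<Sigma> \<Longrightarrow> is_trigger M (EGD b x y) h \<Longrightarrow> h x = h y"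
  unfolding model_def by fastforce

lemma is_trigger_hom: "hom g A B \<Longrightarrow> is_trigger A \<xi> h \<Longrightarrow> is_trigger B \<xi> (g \<circ> h)"
  using inst_hom[of g A B h "body \<xi>" "g \<circ> h"] by (simp add: is_trigger_def)

lemma mem_replace: "(R, us) \<in> replace s t I \<longleftrightarrow> (\<exists>ts. (R, ts) \<in> I \<and> us = map (\<lambda>u. if u = s then t else u) ts)"
  by (force simp: replace_def)

lemma hom_from_replace:
  assumes "hom g I M" "g s = g t"
  shows "hom g (replace s t I) M"
proof -
  have "map g (map (\<lambda>u. if u = s then t else u) ts) = map g ts" for ts
    using assms(2) by auto
  then show ?thesis
    using assms(1) unfolding hom_iff mem_replace by metis
qed

lemma hom_to_replace: "hom (\<lambda>u. if u = Nul n then t else u) I (replace (Nul n) t I)"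
  unfolding hom_iff mem_replace by auto

context dependencies
begin

text \<open>A suitable power of the endomorphism \<open>b \<circ> a\<close> is the identity on
  \<open>adom C\<close>, so \<open>C\<close> is a retract of \<open>Q\<close>: triggers go to
  \<open>Q\<close> along \<open>a\<close>, and witnesses and equalities come back.\<close>

lemma core_model:
  assumes core: "is_core_of J C" and fin: "finite C" and a: "hom a C Q" and b: "hom b Q C"
    and Q: "model \<Sigma> Q"
  shows "model \<Sigma> C"
proof -
  obtain m where m: "\<And>t. t \<in> adom C \<Longrightarrow> ((b \<circ> a) ^^ Suc m) t = t"
    using core_endomorphism_power[OF core fin hom_comp[OF a b]] by blast
  \<comment> \<open>A left inverse of \<open>a\<close> on \<open>adom C\<close>, since
    \<open>k \<circ> a\<close> is the power \<open>Suc m\<close> of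
    \<open>b \<circ> a\<close>.\<close>
  define k where "k = ((b \<circ> a) ^^ m) \<circ> b"
  have k: "hom k Q C"
    unfolding k_def by (rule hom_comp[OF b hom_funpow[OF hom_comp[OF a b]]])
  have ka: "k (a t) = t" if "t \<in> adom C" for t
    using m[OF that] by (simp add: k_def funpow_Suc_right del: funpow.simps)
  show ?thesis
    unfolding model_def
  proof (intro ballI allI impI)
    fix \<xi> h assume \<xi>: "\<xi> \<in> \<Sigma>" and h: "is_trigger C \<xi> h"
    have ah: "is_trigger Q \<xi> (a \<circ> h)"
      using is_trigger_hom[OF a h] .
    have kah: "k (a (h v)) = h v" if "v \<in> bvars \<xi>" for v
      using ka avars_in_adom[of v "body \<xi>" h C] h that by (simp add: is_trigger_def bvars_def)
    show "\<not> active C \<xi> h"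
    proof (cases \<xi>)
      case (TGD c hs)
      then obtain h' where h': "\<And>v. v \<in> avars c \<Longrightarrow> h' v = (a \<circ> h) v" "inst h' hs \<subseteq> Q"
        using model_tgd[OF Q, of c hs "a \<circ> h"] \<xi> ah by blast
      have "inst (k \<circ> h') hs \<subseteq> C"
        by (rule inst_hom[OF k h'(2)]) simp
      moreover have "\<forall>v\<in>avars c. (k \<circ> h') v = h v"
        using h'(1) kah TGD by (simp add: bvars_def)
      ultimately show ?thesis using TGD by (metis active.simps(1))
    next
      case (EGD c x y)
      then have "(a \<circ> h) x = (a \<circ> h) y"
        using model_egd[OF Q, of c x y "a \<circ> h"] \<xi> ah by blast
      then have "h x = h y"
        using kah[of x] kah[of y] egd_vars[of c x y] \<xi> EGD
        by (metis body.simps(2) bvars_def comp_apply)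
      then show ?thesis using EGD by simp
    qed
  qed
qed

section \<open>Core chase steps and homomorphisms\<close>

lemma core_step_cases:
  assumes "step CoreV \<Sigma> (Inst X, H) (Inst X', H')"
  obtains (egd) b x y h n w where "EGD b x y \<in> \<Sigma>" "is_trigger X (EGD b x y) h"
      "{Nul n, w} = {h x, h y}" "w \<noteq> Nul n" "X' = replace (Nul n) w X"
    | (par) P where "\<And>b x y h. EGD b x y \<in> \<Sigma> \<Longrightarrow> is_trigger X (EGD b x y) h \<Longrightarrow> h x = h y"
      "parallel \<Sigma> X P" "is_core_of P X'"
proof -
  consider (1) \<xi> h where "\<xi> \<in> \<Sigma>" "\<not> is_tgd \<xi>" "is_trigger X \<xi> h" "active X \<xi> h" "fire X \<xi> h (Inst X')"
    | (2) P where "\<not> (\<exists>\<xi>\<in>\<Sigma>. \<exists>h. \<not> is_tgd \<xi> \<and> is_trigger X \<xi> h \<and> active X \<xi> h)" "parallel \<Sigma> X P" "is_core_of P X'"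
    using assms unfolding step.simps st.inject by blast
  then show thesis
  proof cases
    case 1
    then obtain b x y where \<xi>: "\<xi> = EGD b x y" by (cases \<xi>) auto
    then have "h x \<noteq> h y" "Inst X' = egd_result X (h x) (h y)" using 1 by auto
    then show thesis
      using egd 1 \<xi> by (cases rule: egd_result_cases[of "h x" "h y" X]) auto
  next
    case 2
    have "h x = h y" if "EGD b x y \<in> \<Sigma>" "is_trigger X (EGD b x y) h" for b x y h
      using 2(1) that by (metis active.simps(2) is_tgd.simps(2))
    then show thesis using par 2 by blast
  qed
qed

lemma core_step_hom:
  assumes "step CoreV \<Sigma> (Inst X, H) (Inst X', H')"
  shows "\<exists>f. hom f X X'"
  using assms
proof (cases rule: core_step_cases)
  case egd
  then show ?thesis using hom_to_replace by blast
next
  case (par P)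
  then obtain f where "hom f P X'"
    unfolding is_core_of_def by blast
  then show ?thesis
    using hom_subset[OF _ parallel_superset[OF par(2)] order.refl] by blast
qed

lemma core_step_finite:
  assumes "step CoreV \<Sigma> (Inst X, H) (Inst X', H')" "finite X"
  shows "finite X'"
  using assms(1)
proof (cases rule: core_step_cases)
  case egd
  then show ?thesis using assms(2) by (simp add: replace_def)
next
  case (par P)
  have "X' \<subseteq> P"
    using par(3) unfolding is_core_of_def by blast
  then show ?thesis
    using parallel_finite[OF finite_\<Sigma> assms(2) par(2)] finite_subset by blast
qed

lemma core_step_not_E:
  assumes "step CoreV \<Sigma> (Inst X, H) (Inst X', H')" "E \<notin> fst ` X"
  shows "E \<notin> fst ` X'"
  using assms(1)
proof (cases rule: core_step_cases)
  case egd
  have "fst ` replace s t X = fst ` X" for s t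
    by (auto simp: replace_def image_image split_beta)
  then show ?thesis using assms(2) egd by metis
next
  case (par P)
  obtain ext where ext: "fires_all \<Sigma> X ext" and P: "P = X \<union> (\<Union>k\<in>act_keys \<Sigma> X. inst (ext k) (heads (fst k)))"
    using par(2) unfolding parallel_iff by blast
  have "(E, ts) \<notin> inst (ext k) (heads (fst k))" if "k \<in> act_keys \<Sigma> X" for k ts
    using act_keysE[OF ext that] inst_not_E by blast
  moreover have "(E, ts) \<notin> X" for ts
    using assms(2) by force
  ultimately have "(E, ts) \<notin> P" for ts
    using P by blast
  moreover have "X' \<subseteq> P"
    using par(3) unfolding is_core_of_def by blast
  ultimately show ?thesis by auto
qed

text \<open>Universality of the chase: terms merged by an egd already have equal images in a model,
  and fresh nulls find witnesses there.\<close>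

lemma core_step_model_hom:
  assumes "step CoreV \<Sigma> (Inst X, H) (Inst X', H')" and g: "hom g X M" and M: "model \<Sigma> M"
  shows "\<exists>g'. hom g' X' M"
  using assms(1)
proof (cases rule: core_step_cases)
  case (egd b x y h n w)
  have "(g \<circ> h) x = (g \<circ> h) y"
    by (rule model_egd[OF M egd(1) is_trigger_hom[OF g egd(2)]])
  then have "g (Nul n) = g w"
    using egd(3) by (auto simp: doubleton_eq_iff)
  then show ?thesis using hom_from_replace[OF g] egd(5) by blast
next
  case (par P)
  have "\<exists>h'. (\<forall>v\<in>bvars \<xi>. h' v = g (h v)) \<and> inst h' (heads \<xi>) \<subseteq> M"
    if \<xi>: "\<xi> \<in> \<Sigma>" "is_tgd \<xi>" and h: "is_trigger X \<xi> h" for \<xi> h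
  proof -
    obtain b hs where bh: "\<xi> = TGD b hs"
      using \<xi>(2) by (cases \<xi>) auto
    then show ?thesis
      using model_tgd[OF M, of b hs "g \<circ> h"] \<xi> is_trigger_hom[OF g h]
      by (metis body.simps(1) bvars_def comp_apply heads.simps(1))
  qed
  then obtain g' where "hom g' P M"
    using parallel_hom[OF par(2) g order.refl] by blast
  moreover have "X' \<subseteq> P"
    using par(3) unfolding is_core_of_def by blast
  ultimately show ?thesis
    using hom_subset[OF _ _ order.refl] by blast
qed

text \<open>The replaced null disappears, and its replacement already occurs in
  \<open>X\<close>.\<close>

lemma egd_step_nulls:
  assumes "EGD b x y \<in> \<Sigma>" "is_trigger X (EGD b x y) h" "{Nul n, w} = {h x, h y}" "w \<noteq> Nul n" "finite X"
  shows "card (nulls_of (replace (Nul n) w X)) < card (nulls_of X)"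
proof (rule psubset_card_mono[OF finite_nulls_of[OF assms(5)]])
  have hX: "h x \<in> adom X" "h y \<in> adom X"
    using avars_in_adom assms(2) egd_vars[OF assms(1)] by (auto simp: is_trigger_def)
  then have nX: "Nul n \<in> adom X" "w \<in> adom X"
    using assms(3) by (metis insertCI insertE singletonD)+
  have "adom (replace (Nul n) w X) \<subseteq> adom X - {Nul n}"
  proof
    fix u assume "u \<in> adom (replace (Nul n) w X)"
    then obtain R us where "(R, us) \<in> replace (Nul n) w X" "u \<in> set us" by (rule adomE)
    then obtain ts t where "(R, ts) \<in> X" "t \<in> set ts" "u = (if t = Nul n then w else t)"
      by (auto simp: mem_replace)
    then show "u \<in> adom X - {Nul n}"
      using nX(2) assms(4) adomI by (auto split: if_splits)
  qed
  then have "nulls_of (replace (Nul n) w X) \<subseteq> nulls_of X - {n}"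
    by (auto simp: nulls_of_iff)
  moreover have "n \<in> nulls_of X"
    using nX(1) by (simp add: nulls_of_iff)
  ultimately show "nulls_of (replace (Nul n) w X) \<subset> nulls_of X"
    by blast
qed

end

section \<open>The core chase\<close>

context dependencies
begin

lemma finite_sigma_tgd: "finite \<Sigma>t"
proof -
  have "rels_of \<Sigma> = (\<Union>\<xi>\<in>\<Sigma>. fst ` (set (body \<xi>) \<union> set (heads \<xi>)))"
    by (force simp: rels_of_def)
  then have rels: "finite (rels_of \<Sigma>)"
    using finite_\<Sigma> by simp
  let ?F = "\<lambda>\<xi>. case \<xi> of EGD b x y \<Rightarrow> TGD b [(E, [RVar x, RVar y]), (E, [RVar y, RVar x])] | _ \<Rightarrow> \<xi>"
  have "{TGD b [(E, [RVar x, RVar y]), (E, [RVar y, RVar x])] | b x y. EGD b x y \<in> \<Sigma>} \<subseteq> ?F ` \<Sigma>"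
    by force
  then have "finite {TGD b [(E, [RVar x, RVar y]), (E, [RVar y, RVar x])] | b x y. EGD b x y \<in> \<Sigma>}"
    by (rule finite_subset) (simp add: finite_\<Sigma>)
  moreover have "{repl_rule E R (ar R) i :: ('r,'c) dep | R i. R \<in> rels_of \<Sigma> \<and> i < ar R} =
      (\<Union>R\<in>rels_of \<Sigma>. repl_rule E R (ar R) ` {..<ar R})"
    by auto
  ultimately show ?thesis
    unfolding sigma_tgd_def using finite_\<Sigma> rels by simp
qed

lemma sigma_tgd_is_tgd: "\<xi> \<in> \<Sigma>t \<Longrightarrow> is_tgd \<xi>"
  by (auto simp: sigma_tgd_def repl_rule_def)

lemma sigma_tgd_cases:
  assumes "\<xi> \<in> \<Sigma>t"
  obtains (tgd) "\<xi> \<in> \<Sigma>" "is_tgd \<xi>"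
  | (egd) b x y where "EGD b x y \<in> \<Sigma>" "\<xi> = TGD b [(E, [RVar x, RVar y]), (E, [RVar y, RVar x])]"
  | (repl) R i where "R \<in> rels_of \<Sigma>" "i < ar R" "\<xi> = repl_rule E R (ar R) i"
  using assms unfolding sigma_tgd_def by blast

text \<open>Equality as an interpretation of \<open>E\<close>, taken over all terms so that every
  map on terms preserves it.\<close>

definition diag :: "('r,'c) atom set" where
  "diag = {(E, [t, t]) | t. True}"

lemma hom_diag: "hom f A B \<Longrightarrow> hom f (A \<union> diag) (B \<union> diag)"
  by (auto simp: hom_iff diag_def)

text \<open>With the egds valid in \<open>X\<close>, equality satisfies the translated egds and the
  congruence rules without new atoms. Only the tgds of \<Sigma> need the parallel step, so one such
  step answers a whole parallel step of the translated chase.\<close>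

lemma diag_satisfies:
  assumes par: "parallel \<Sigma> X P" and egds: "\<And>b x y h. EGD b x y \<in> \<Sigma> \<Longrightarrow> is_trigger X (EGD b x y) h \<Longrightarrow> h x = h y"
    and X: "E \<notin> fst ` X" and \<xi>: "\<xi> \<in> \<Sigma>t" and h: "is_trigger (X \<union> diag) \<xi> h"
  shows "\<exists>h'. (\<forall>v\<in>bvars \<xi>. h' v = h v) \<and> inst h' (heads \<xi>) \<subseteq> P \<union> diag"
proof -
  have XP: "X \<subseteq> P" using parallel_superset[OF par] .
  have notE: "is_trigger X \<zeta> h" if "\<zeta> \<in> \<Sigma>" "is_trigger (X \<union> diag) \<zeta> h" for \<zeta>
  proof -
    have "(R, us) \<notin> diag" if "(R, us) \<in> inst h (body \<zeta>)" for R us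
      using inst_not_E[OF \<open>\<zeta> \<in> \<Sigma>\<close>] that by (auto simp: diag_def)
    then show ?thesis
      using that(2) unfolding is_trigger_def by auto
  qed
  show ?thesis
    using \<xi>
  proof (cases rule: sigma_tgd_cases)
    case tgd
    then obtain h' where "\<forall>v\<in>bvars \<xi>. h' v = h v" "inst h' (heads \<xi>) \<subseteq> P"
      using parallel_satisfies[OF par _ _ notE] h by blast
    then show ?thesis by blast
  next
    case (egd b x y)
    have "is_trigger (X \<union> diag) (EGD b x y) h"
      using h egd(2) by (simp add: is_trigger_def)
    then have "h x = h y"
      using egds[OF egd(1)] notE[OF egd(1)] by blast
    then have "inst h (heads \<xi>) \<subseteq> diag"
      using egd(2) by (auto simp: inst_def diag_def)
    then show ?thesis by blast
  next
    case (repl R i)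
    let ?n = "ar R"
    have "(E, [h ?n, h (Suc ?n)]) \<in> X \<union> diag"
      using h repl(3) by (simp add: is_trigger_def repl_rule_def inst_def)
    moreover have "(E, [h ?n, h (Suc ?n)]) \<notin> X"
      using X by force
    ultimately have eq: "h ?n = h (Suc ?n)"
      by (auto simp: diag_def)
    have "map (inst_t h) (map (\<lambda>j. if j = i then RVar (Suc ?n) else RVar j) [0..<?n]) =
        map (inst_t h) (map (\<lambda>j. if j = i then RVar ?n else RVar j) [0..<?n])"
      using eq by simp
    then have "inst h (heads \<xi>) \<subseteq> inst h (body \<xi>)"
      unfolding repl(3) repl_rule_def inst_def by (simp del: map_map)
    then have "inst h (heads \<xi>) \<subseteq> P \<union> diag"
      using h XP unfolding is_trigger_def by blast
    then show ?thesis by blast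
  qed
qed

lemma model_saturated:
  assumes "model \<Sigma>t J"
  shows "saturated E ar (rels_of \<Sigma>) J"
  unfolding saturated_def
proof (intro ballI allI impI)
  fix R us i t
  assume R: "R \<in> rels_of \<Sigma>" "(R, us) \<in> J" "length us = ar R" "i < ar R" "(us ! i, t) \<in> Erel E J"
  obtain b hs where bh: "(repl_rule E R (ar R) i :: ('r,'c) dep) = TGD b hs"
    by (simp add: repl_rule_def)
  obtain h where h: "inst h b = {(E, [us ! i, t]), (R, us)}" "inst h hs = {(R, us[i := t])}"
    using repl_trigger[of us "ar R" i R t] R bh by auto
  have "is_trigger J (TGD b hs) h"
    using h R by (auto simp: is_trigger_def Erel_def)
  then have "\<not> active J (TGD b hs) h"
    using assms sigma_tgd_repl[OF R(1,4)] bh unfolding model_def by metis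
  then show "(R, us[i := t]) \<in> J"
    using active_full[OF repl_rule_full[OF bh], of J h] h by simp
qed

text \<open>The homomorphism \<open>g\<close> is constant on \<open>E\<close>-classes and fixes
  constants, so no class contains two constants. This makes the quotient possible without
  identifying constants, and \<open>g\<close> itself factors through it.\<close>

lemma quotient_model:
  assumes J: "model \<Sigma>t J" and g: "hom g J (X \<union> diag)" and X: "E \<notin> fst ` X"
  shows "\<exists>Q r. model \<Sigma> Q \<and> hom r {a \<in> J. fst a \<noteq> E} Q \<and> hom g Q X"
proof -
  define L where "L = (Erel E J)\<^sup>*"
  have gE: "g s = g t" if "(s, t) \<in> Erel E J" for s t
  proof -
    have "(E, [s, t]) \<in> J" using that by (simp add: Erel_def)
    then have "(E, [g s, g t]) \<in> X \<union> diag"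
      using hom_atom[OF g, of E "[s, t]"] by simp
    moreover have "(E, [g s, g t]) \<notin> X" using X by force
    ultimately show ?thesis by (auto simp: diag_def)
  qed
  have gL: "g s = g t" if "(s, t) \<in> L" for s t
    using that unfolding L_def by (induction rule: rtrancl_induct) (auto simp: gE)
  have sym: "(t, s) \<in> L" if "(s, t) \<in> L" for s t
    using Erel_rtrancl_sym that unfolding L_def by metis
  have trans: "(s, u) \<in> L" if "(s, t) \<in> L" "(t, u) \<in> L" for s t u
    using that unfolding L_def by (rule rtrancl_trans)
  have refl: "(s, s) \<in> L" for s
    by (simp add: L_def)
  \<comment> \<open>A class containing a constant must be represented by a constant. As
    \<open>rp s\<close> depends only on the class of \<open>s\<close>, so does the choice
    \<open>r s\<close>.\<close>
  define rp where "rp s t \<longleftrightarrow> (s, t) \<in> L \<and> ((\<exists>c. (s, Cst c) \<in> L) \<longrightarrow> t \<in> range Cst)" for s t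
  define r where "r s = (SOME t. rp s t)" for s
  have "\<exists>t. rp s t" for s
    unfolding rp_def using refl by blast
  then have rp: "rp s (r s)" for s
    unfolding r_def by (metis someI)
  have rL: "(s, r s) \<in> L" for s
    using rp by (simp add: rp_def)
  have r_eq: "r s = r t" if "(s, t) \<in> L" for s t
  proof -
    have "rp s = rp t"
      unfolding rp_def fun_eq_iff using that sym trans by blast
    then show ?thesis by (simp add: r_def)
  qed
  have r_conn: "(s, t) \<in> L" if "r s = r t" for s t
    using rL[of s] rL[of t] that sym trans by metis
  have r_Cst: "r (Cst c) = Cst c" for c
  proof -
    have "r (Cst c) \<in> range Cst"
      using rp[of "Cst c"] refl unfolding rp_def by blast
    then obtain d where d: "r (Cst c) = Cst d" by blast
    then have "g (Cst c) = g (Cst d)"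
      using gL rL by metis
    then show ?thesis using d hom_Cst[OF g] by simp
  qed
  define Q where "Q = (\<lambda>(R, ts). (R, map r ts)) ` {a \<in> J. fst a \<noteq> E}"
  have Q: "(R, us) \<in> Q \<longleftrightarrow> R \<noteq> E \<and> (\<exists>ws. (R, ws) \<in> J \<and> us = map r ws)" for R us
    by (auto simp: Q_def)
  have rQ: "hom r {a \<in> J. fst a \<noteq> E} Q"
    using r_Cst by (simp add: hom_def Q_def)
  have gQ: "hom g Q X"
    unfolding hom_iff
  proof (intro conjI allI impI)
    show "g (Cst c) = Cst c" for c using hom_Cst[OF g] .
    fix R us assume "(R, us) \<in> Q"
    then obtain ws where ws: "R \<noteq> E" "(R, ws) \<in> J" "us = map r ws"
      using Q by blast
    have "map g us = map g ws"
      using ws(3) gL rL by (metis (no_types, lifting) comp_apply map_eq_conv map_map)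
    then show "(R, map g us) \<in> X"
      using hom_atom[OF g ws(2)] ws(1) by (auto simp: diag_def)
  qed
  have "model \<Sigma> Q"
    unfolding model_def
  proof (intro ballI allI impI)
    fix \<xi> h assume \<xi>: "\<xi> \<in> \<Sigma>" and h: "is_trigger Q \<xi> h"
    have "\<exists>s. s \<in> dm J \<and> r s = h v" if "v \<in> bvars \<xi>" for v
    proof -
      have "h v \<in> adom Q"
        using avars_in_adom[of v "body \<xi>" h Q] h that by (simp add: is_trigger_def bvars_def)
      then obtain R us where "(R, us) \<in> Q" "h v \<in> set us" by (rule adomE)
      then obtain ws s where "(R, ws) \<in> J" "s \<in> set ws" "h v = r s"
        using Q by auto
      then show ?thesis
        using adomI[of R ws J s] by (auto simp: dm_def)
    qed
    then obtain k where k: "\<And>v. v \<in> bvars \<xi> \<Longrightarrow> k v \<in> dm J \<and> r (k v) = h v"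
      by metis
    have tr: "is_trigger J \<xi> k"
    proof (rule lift_trigger[OF model_saturated[OF J] \<xi> wf[OF \<xi>] r_Cst _ _ h k])
      show "(s, t) \<in> (Erel E J)\<^sup>*" if "r s = r t" for s t
        using r_conn[OF that] by (simp add: L_def)
      show "\<exists>ws. (R, ws) \<in> J \<and> us = map r ws" if "(R, us) \<in> Q" for R us
        using Q that by blast
    qed
    show "\<not> active Q \<xi> h"
    proof (cases \<xi>)
      case (TGD b hs)
      then have "TGD b hs \<in> \<Sigma>t" "is_trigger J (TGD b hs) k"
        using sigma_tgd_tgd[OF \<xi>] tr by auto
      then obtain k' where k': "\<And>v. v \<in> avars b \<Longrightarrow> k' v = k v" "inst k' hs \<subseteq> J"
        using model_tgd[OF J] by metis
      have "inst k' hs \<subseteq> {a \<in> J. fst a \<noteq> E}"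
        using k'(2) inst_not_E[OF \<xi>] TGD by fastforce
      then have "inst (r \<circ> k') hs \<subseteq> Q"
        using inst_hom[OF rQ, of k' hs "r \<circ> k'"] by simp
      moreover have "\<forall>v\<in>avars b. (r \<circ> k') v = h v"
        using k'(1) k TGD by (simp add: bvars_def)
      ultimately show ?thesis using TGD by (metis active.simps(1))
    next
      case (EGD b x y)
      let ?hs = "[(E, [RVar x, RVar y]), (E, [RVar y, RVar x])]"
      have xy: "x \<in> avars b" "y \<in> avars b"
        using egd_vars \<xi> EGD by blast+
      have "is_trigger J (TGD b ?hs) k"
        using tr EGD by (simp add: is_trigger_def)
      then obtain k' where k': "\<And>v. v \<in> avars b \<Longrightarrow> k' v = k v" "inst k' ?hs \<subseteq> J"
        using model_tgd[OF J sigma_tgd_egd[OF \<xi>[unfolded EGD]]] by metis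
      have "(k x, k y) \<in> Erel E J"
        using k' xy by (auto simp: inst_def Erel_def)
      then have "r (k x) = r (k y)"
        by (intro r_eq) (simp add: L_def)
      then have "h x = h y"
        using k xy EGD by (simp add: bvars_def)
      then show ?thesis using EGD by simp
    qed
  qed
  then show ?thesis using rQ gQ by blast
qed

end

section \<open>Infinite core chases\<close>

locale infinite_core_chase = dependencies \<Sigma> ar E
  for \<Sigma> :: "('r,'c) dep set" and ar :: "'r \<Rightarrow> nat" and E :: 'r +
  fixes X :: "nat \<Rightarrow> ('r,'c) atom set"
  assumes finite_X0: "finite (X 0)"
    and E_X0: "E \<notin> fst ` X 0"
    and core_step: "step CoreV \<Sigma> (Inst (X n), {}) (Inst (X (Suc n)), {})"
begin

lemma finite_X: "finite (X n)"
proof (induction n)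
  case 0
  then show ?case by (rule finite_X0)
next
  case (Suc n)
  then show ?case by (rule core_step_finite[OF core_step])
qed

lemma E_X: "E \<notin> fst ` X n"
proof (induction n)
  case 0
  then show ?case by (rule E_X0)
next
  case (Suc n)
  then show ?case by (rule core_step_not_E[OF core_step])
qed

lemma hom_X:
  assumes "i \<le> j"
  shows "\<exists>f. hom f (X i) (X j)"
  using assms
proof (induction j rule: dec_induct)
  case base
  then show ?case using hom_id by blast
next
  case (step j)
  then show ?case using core_step_hom[OF core_step] hom_comp by blast
qed

text \<open>Egd steps lose nulls, so only finitely many occur in a row. The stage found satisfies
  all egds, and its successor is a core.\<close>

lemma parallel_step_later:
  "\<exists>k\<ge>n. \<exists>P. parallel \<Sigma> (X k) P \<and> is_core_of P (X (Suc k)) \<and>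
     (\<forall>b x y h. EGD b x y \<in> \<Sigma> \<longrightarrow> is_trigger (X k) (EGD b x y) h \<longrightarrow> h x = h y)"
proof (induction "card (nulls_of (X n))" arbitrary: n rule: less_induct)
  case less
  show ?case
    using core_step[of n]
  proof (cases rule: core_step_cases)
    case (egd b x y h m w)
    then have "card (nulls_of (X (Suc n))) < card (nulls_of (X n))"
      using egd_step_nulls[OF egd(1-4) finite_X] by simp
    from less[OF this] show ?thesis
      by (meson Suc_leD)
  next
    case (par P)
    then show ?thesis by blast
  qed
qed

text \<open>Accessibility makes an arbitrarily chosen branch of the translated chase stop. Along it,
  \<open>g\<close> is pushed to ever later stages, and \<open>n\<close> may jump because egd steps
  have no counterpart on the translated side.\<close>

lemma terminal_tgd_model:
  assumes "Wellfounded.accp (\<lambda>y x. step CoreV \<Sigma>t x y) c" "c = (Inst J, {})"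
    and "finite J" "hom f (X 0) J" "hom g J (X n \<union> diag)"
  shows "\<exists>J' f g n. model \<Sigma>t J' \<and> hom f (X 0) J' \<and> hom g J' (X n \<union> diag)"
  using assms
proof (induction arbitrary: J f g n rule: accp.induct)
  case (accI c)
  note IH = accI(2) and c = accI(3) and fin = accI(4) and f = accI(5) and g = accI(6)
  show ?case
  proof (cases "model \<Sigma>t J")
    case True
    then show ?thesis using f g by blast
  next
    case False
    then have act: "\<exists>\<xi>\<in>\<Sigma>t. \<exists>h. is_tgd \<xi> \<and> is_trigger J \<xi> h \<and> active J \<xi> h"
      using sigma_tgd_is_tgd unfolding model_def by blast
    obtain P' where P': "parallel \<Sigma>t J P'"
      using parallel_exists[OF finite_sigma_tgd fin] by blast
    have finP': "finite P'"
      using parallel_finite[OF finite_sigma_tgd fin P'] .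
    obtain C where C: "is_core_of P' C"
      using core_exists[OF finP'] by blast
    then obtain cr where CP: "C \<subseteq> P'" and cr: "hom cr P' C"
      unfolding is_core_of_def by blast
    have "\<not> (\<exists>\<xi>\<in>\<Sigma>t. \<exists>h. \<not> is_tgd \<xi> \<and> is_trigger J \<xi> h \<and> active J \<xi> h)"
      using sigma_tgd_is_tgd by blast
    then have st: "step CoreV \<Sigma>t c (Inst C, {})"
      unfolding c step.simps using act P' C by blast
    have finC: "finite C" using finP' CP finite_subset by blast
    have fC: "hom (cr \<circ> f) (X 0) C"
      using hom_comp[OF hom_subset[OF f order.refl parallel_superset[OF P']] cr] .
    obtain k P where k: "n \<le> k" and P: "parallel \<Sigma> (X k) P" "is_core_of P (X (Suc k))"
      and egds: "\<And>b x y h. EGD b x y \<in> \<Sigma> \<Longrightarrow> is_trigger (X k) (EGD b x y) h \<Longrightarrow> h x = h y"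
      using parallel_step_later[of n] by blast
    obtain e where e: "hom e (X n) (X k)"
      using hom_X[OF k] by blast
    \<comment> \<open>Before the parallel step is mirrored, the target moves to a stage
      \<open>k\<close> at which the egds hold.\<close>
    define g1 where "g1 = e \<circ> g"
    have g1: "hom g1 J (X k \<union> diag)"
      unfolding g1_def by (rule hom_comp[OF g hom_diag[OF e]])
    have "\<exists>h'. (\<forall>v\<in>bvars \<xi>. h' v = g1 (h v)) \<and> inst h' (heads \<xi>) \<subseteq> P \<union> diag"
      if "\<xi> \<in> \<Sigma>t" "is_trigger J \<xi> h" for \<xi> h
      using diag_satisfies[OF P(1) egds E_X that(1) is_trigger_hom[OF g1 that(2)]] by simp
    moreover have "X k \<union> diag \<subseteq> P \<union> diag"
      using parallel_superset[OF P(1)] by blast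
    ultimately have "\<exists>g2. hom g2 P' (P \<union> diag)"
      by (intro parallel_hom[OF P' g1]) auto
    then obtain g2 where g2: "hom g2 P' (P \<union> diag)" by blast
    obtain cr' where cr': "hom cr' P (X (Suc k))"
      using P(2) unfolding is_core_of_def by blast
    have "hom (cr' \<circ> g2) C (X (Suc k) \<union> diag)"
      by (rule hom_comp[OF hom_subset[OF g2 CP order.refl] hom_diag[OF cr']])
    then show ?thesis
      using IH[OF st refl finC fC] by blast
  qed
qed

lemma not_accp_tgd: "\<not> Wellfounded.accp (\<lambda>y x. step CoreV \<Sigma>t x y) (Inst (X 0), {})"
proof
  assume "Wellfounded.accp (\<lambda>y x. step CoreV \<Sigma>t x y) (Inst (X 0), {})"
  then obtain J f g n where J: "model \<Sigma>t J" and f: "hom f (X 0) J" and g: "hom g J (X n \<union> diag)"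
    using terminal_tgd_model[OF _ refl finite_X0 hom_id[of "X 0" "X 0"] hom_id[of "X 0" "X 0 \<union> diag"]]
    by blast
  obtain Q r where Q: "model \<Sigma> Q" and r: "hom r {a \<in> J. fst a \<noteq> E} Q" and gQ: "hom g Q (X n)"
    using quotient_model[OF J g E_X] by blast
  have "hom f (X 0) {a \<in> J. fst a \<noteq> E}"
    using f E_X0 unfolding hom_iff by force
  then have fQ: "hom (r \<circ> f) (X 0) Q"
    using hom_comp r by blast
  have univ: "\<exists>a. hom a (X j) Q" for j
  proof (induction j)
    case 0
    then show ?case using fQ by blast
  next
    case (Suc j)
    then show ?case using core_step_model_hom[OF core_step _ Q] by blast
  qed
  \<comment> \<open>Stage \<open>n\<close> itself need not be a core, since egd steps do not take
    cores; a stage reached by a parallel step is one.\<close>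
  obtain k P where k: "n \<le> k" and core: "is_core_of P (X (Suc k))"
    using parallel_step_later[of n] by blast
  obtain e where "hom e (X n) (X (Suc k))"
    using hom_X[of n "Suc k"] k by auto
  then have "hom (e \<circ> g) Q (X (Suc k))"
    using hom_comp[OF gQ] by blast
  then have "model \<Sigma> (X (Suc k))"
    using core_model[OF core finite_X] univ[of "Suc k"] Q by blast
  then show False
    using core_step[of "Suc k"] unfolding model_def step.simps by blast
qed

end

context dependencies
begin

lemma terminates_core:
  assumes I: "finite I" "E \<notin> fst ` I" and T: "terminates CoreV \<Sigma>t I"
  shows "terminates CoreV \<Sigma> I"
  unfolding terminates_def
proof
  assume "\<exists>f. f 0 = (Inst I, {}) \<and> (\<forall>n. step CoreV \<Sigma> (f n) (f (Suc n)))"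
  then obtain f where f0: "f 0 = (Inst I, {})" and st: "\<And>n. step CoreV \<Sigma> (f n) (f (Suc n))"
    by blast
  have inst: "\<exists>Y. fst (f n) = Inst Y" for n
    using st[of n] by (cases "f n"; cases "fst (f n)") auto
  have hist: "snd (f n) = {}" for n
  proof (induction n)
    case 0
    then show ?case using f0 by simp
  next
    case (Suc n)
    obtain Y where "f n = (Inst Y, {})"
      using inst[of n] Suc by (metis prod.collapse)
    then have "step CoreV \<Sigma> (Inst Y, {}) (fst (f (Suc n)), snd (f (Suc n)))"
      using st[of n] by simp
    then show ?case unfolding step.simps by blast
  qed
  obtain X where X: "\<And>n. fst (f n) = Inst (X n)"
    using inst by metis
  have f: "f n = (Inst (X n), {})" for n
    using X hist by (metis prod.collapse)
  have "X 0 = I" using f[of 0] f0 by simp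
  interpret infinite_core_chase \<Sigma> ar E X
  proof
    show "finite (X 0)" "E \<notin> fst ` X 0"
      using I \<open>X 0 = I\<close> by simp_all
    show "step CoreV \<Sigma> (Inst (X n), {}) (Inst (X (Suc n)), {})" for n
      using st[of n] f by simp
  qed
  show False
    using not_accp_tgd T \<open>X 0 = I\<close> unfolding terminates_iff_accp by simp
qed

end

theorem theorem2:
  fixes \<Sigma> :: "('r,'c) dep set" and I :: "('r,'c) atom set"
    and ar :: "'r \<Rightarrow> nat" and E :: 'r and v :: variant
  assumes "finite \<Sigma>" and "finite I"
    and "\<forall>\<xi>\<in>\<Sigma>. wf_dep ar \<xi>"
    and "\<forall>(R,ts)\<in>I. length ts = ar R"
    and "E \<notin> rels_of \<Sigma>" and "E \<notin> fst ` I"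
    and "terminates v (sigma_tgd E ar \<Sigma>) I"
  shows "terminates v \<Sigma> I"
proof -
  interpret dependencies \<Sigma> ar E
    using assms by unfold_locales auto
  show ?thesis
    using terminates_core terminates_non_core assms by (cases "v = CoreV") auto
qed

end
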